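(* Let $E$ be a locally compact separable metric space and $m$ a positive Radon measure on $E$ with full topological support. Let $X=(\Omega,X_t,\mathbb{P}_x,\zeta)$ be an explosive $m$-symmetric Markov process on $E$ in Class (T), with ground state $\phi_0$ (strictly positive, bounded continuous version), and let $\nu^{\phi_0}(B)=\int_B\phi_0\,dm\big/\int_E\phi_0\,dm$ for $B\in\mathscr{B}(E)$. If $X$ is intrinsically ultracontractive, then for any probability measure $\nu$ on $E$ and any $B\in\mathscr{B}(E)$, $$\lim_{t\to\infty}\mathbb{P}_\nu(X_t\in B\mid t<\zeta)=\nu^{\phi_0}(B).$$
   Context: Setting and notation: $\mathscr{B}(E)$ is the Borel $\sigma$-algebra of $E$, $b\mathscr{B}(E)$ the bounded Borel functions and $bC(E)$ the bounded continuous functions on $E$. $X$ lives on $E$ with an adjoined cemetery point $\Delta$; $\zeta=\inf\{t>0: X_t=\Delta\}$ is the lifetime, and functions on $E$ are extended by $0$ at $\Delta$. The semigroup and resolvent are $p_tf(x)=\mathbb{E}_x(f(X_t))$ and $R_\alpha f(x)=\mathbb{E}_x\left(\int_0^\infty e^{-\alpha t}f(X_t)\,dt\right)$. $m$-symmetric means $\int_E (p_tf)g\,dm=\int_E f\,(p_tg)\,dm$. For a probability measure $\nu$, $\mathbb{P}_\nu(\cdot)=\int_E\mathbb{P}_x(\cdot)\,d\nu(x)$. Class (T): $X$ is in Class (T) if it satisfies (I) Irreducibility: if a Borel set $A$ satisfies $p_t(1_Af)=1_Ap_tf$ $m$-a.e. for all $f\in L^2(E;m)\cap b\mathscr{B}(E)$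 and $t>0$, then $m(A)=0$ or $m(E\setminus A)=0$; (II) Strong Feller property: $p_t(b\mathscr{B}(E))\subset bC(E)$ for each $t>0$; (III) Tightness: for any $\epsilon>0$ there is a compact set $K\subset E$ with $\sup_{x\in E}R_11_{K^c}(x)\le\epsilon$. Explosive means not conservative, i.e. it is not the case that $\mathbb{P}_x(\zeta=\infty)=1$ for all $x\in E$. Dirichlet form: $\mathcal{D}(\mathcal{E})=\{u\in L^2(E;m): \lim_{t\to0}\frac1t(u-p_tu,u)_m<\infty\}$, $\mathcal{E}(u,v)=\lim_{t\to0}\frac1t(u-p_tu,v)_m$, where $(\cdot,\cdot)_m$ is the $L^2(E;m)$ inner product. Put $\lambda_0=\inf\{\mathcal{E}(u,u): u\in\mathcal{D}(\mathcal{E}),\ \|u\|_2=1\}$. A ground state is a function $\phi_0\in\mathcal{D}(\mathcal{E})$ with $\|\phi_0\|_2=1$ and $\mathcal{E}(\phi_0,\phi_0)=\lambda_0$. Under the stated hypotheses it exists, has a bounded continuous version with $\phi_0(x)>0$ for all $x\in E$, and belongs to $L^1(E;m)$. Intrinsic ultracontractivity: let $p_t^{\phi_0}f(x)=e^{\lambda_0t}\frac{1}{\phi_0(x)}p_t(\phi_0f)(x)$, a semigroup symmetric with respect to $\phi_0^2m$. $X$ is intrinsically ultracontractive if for every $t>0$ there is a constant $c_t<\infty$ such that $p_t^{\phi_0}$ is bounded from $L^1(E;\phi_0^2m)$ to $L^\infty(E;\phi_0^2m)$ with operator norm at most $c_t$. *)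

theory Defs
  imports "HOL-Probability.Probability"
begin

section \<open>The state space and the process\<close>

text \<open>
  The state space $E$ is a type of class \<open>metric_space\<close> and \<open>second_countable_topology\<close> (for metric
  spaces: separable). The cemetery is \<open>None\<close>, and \<open>Some x\<close> is the point $x$ of $E$. The topology
  on $E$ with the cemetery adjoined is that of the one-point compactification (the cemetery is
  isolated if $E$ is compact).
\<close>

abbreviation cemetery_topology :: "'a::topological_space option topology" where
  "cemetery_topology \<equiv> Alexandroff_compactification euclidean"

definition borel_cemetery :: "'a::topological_space option measure" where
  "borel_cemetery = sigma UNIV {U. openin cemetery_topology U}"

definition lifetime :: "(real \<Rightarrow> 'w \<Rightarrow> 'a option) \<Rightarrow> 'w \<Rightarrow> ereal" where
  "lifetime X \<omega> = Inf {ereal t | t. t > 0 \<and> X t \<omega> = None}"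

definition natural_filtration ::
    "'w measure \<Rightarrow> (real \<Rightarrow> 'w \<Rightarrow> 'a::topological_space option) \<Rightarrow> real \<Rightarrow> 'w measure" where
  "natural_filtration M X t =
     sigma (space M) {X s -` A \<inter> space M | s A. 0 \<le> s \<and> s \<le> t \<and> A \<in> sets borel_cemetery}"

text \<open>
  Time is $[0,\infty)$; the values of \<open>X t\<close> for \<open>t < 0\<close> play no role. A process that is Markov with
  respect to some admissible filtration is Markov with respect to the natural one. Neither left
  limits nor the strong Markov property is required, so Hunt processes are included.
\<close>

locale markov_process =
  fixes M :: "'w measure"
    and X :: "real \<Rightarrow> 'w \<Rightarrow> 'a::{metric_space, second_countable_topology} option"
    and P :: "'a option \<Rightarrow> 'w measure"
  assumes measurable_X: "t \<ge> 0 \<Longrightarrow> X t \<in> M \<rightarrow>\<^sub>M borel_cemetery"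
    and prob_space_P: "prob_space (P x)"
    and sets_P: "sets (P x) = sets M"
    and measurable_P: "t \<ge> 0 \<Longrightarrow> B \<in> sets borel_cemetery \<Longrightarrow>
          (\<lambda>x. measure (P x) (X t -` B \<inter> space M)) \<in> borel_measurable borel_cemetery"
    and markov_property: "s \<ge> 0 \<Longrightarrow> t \<ge> 0 \<Longrightarrow> B \<in> sets borel_cemetery \<Longrightarrow>
          AE \<omega> in P x. real_cond_exp (P x) (natural_filtration M X t)
              (\<lambda>\<omega>'. indicator B (X (s + t) \<omega>')) \<omega>
            = measure (P (X t \<omega>)) (X s -` B \<inter> space M)"
    and normal: "AE \<omega> in P x. X 0 \<omega> = x"
    and cemetery_trap: "t \<ge> 0 \<Longrightarrow> AE \<omega> in P None. X t \<omega> = None"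
    and dead_after_lifetime: "\<omega> \<in> space M \<Longrightarrow> t \<ge> 0 \<Longrightarrow> lifetime X \<omega> \<le> ereal t \<Longrightarrow> X t \<omega> = None"
    and right_continuous: "\<omega> \<in> space M \<Longrightarrow> t \<ge> 0 \<Longrightarrow>
          limitin cemetery_topology (\<lambda>s. X s \<omega>) (X t \<omega>) (at_right t)"

definition ext_cemetery :: "('a \<Rightarrow> real) \<Rightarrow> 'a option \<Rightarrow> real" where
  "ext_cemetery f z = (case z of None \<Rightarrow> 0 | Some x \<Rightarrow> f x)"

definition semigroup_op ::
    "(real \<Rightarrow> 'w \<Rightarrow> 'a option) \<Rightarrow> ('a option \<Rightarrow> 'w measure) \<Rightarrow> real \<Rightarrow> ('a \<Rightarrow> real) \<Rightarrow> 'a \<Rightarrow> real" where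
  "semigroup_op X P t f x = (\<integral>\<omega>. ext_cemetery f (X t \<omega>) \<partial>P (Some x))"

definition resolvent_op ::
    "(real \<Rightarrow> 'w \<Rightarrow> 'a option) \<Rightarrow> ('a option \<Rightarrow> 'w measure) \<Rightarrow> real \<Rightarrow> ('a \<Rightarrow> real) \<Rightarrow> 'a \<Rightarrow> real" where
  "resolvent_op X P \<alpha> f x =
     (\<integral>\<omega>. (LBINT t:{0..}. exp (- \<alpha> * t) * ext_cemetery f (X t \<omega>)) \<partial>P (Some x))"

definition conservative ::
    "'w measure \<Rightarrow> (real \<Rightarrow> 'w \<Rightarrow> 'a option) \<Rightarrow> ('a option \<Rightarrow> 'w measure) \<Rightarrow> bool" where
  "conservative M X P \<longleftrightarrow> (\<forall>x. measure (P (Some x)) {\<omega> \<in> space M. lifetime X \<omega> = \<infinity>} = 1)"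

abbreviation explosive ::
    "'w measure \<Rightarrow> (real \<Rightarrow> 'w \<Rightarrow> 'a option) \<Rightarrow> ('a option \<Rightarrow> 'w measure) \<Rightarrow> bool" where
  "explosive M X P \<equiv> \<not> conservative M X P"

text \<open>The probability of an event under the initial distribution \<open>\<nu>\<close> on $E$.\<close>

definition prob_init :: "('a option \<Rightarrow> 'w measure) \<Rightarrow> 'a measure \<Rightarrow> 'w set \<Rightarrow> real" where
  "prob_init P \<nu> \<Lambda> = (\<integral>x. measure (P (Some x)) \<Lambda> \<partial>\<nu>)"

definition cond_prob_init ::
    "('a option \<Rightarrow> 'w measure) \<Rightarrow> 'a measure \<Rightarrow> 'w set \<Rightarrow> 'w set \<Rightarrow> real" where
  "cond_prob_init P \<nu> \<Lambda> \<Gamma> = prob_init P \<nu> (\<Lambda> \<inter> \<Gamma>) / prob_init P \<nu> \<Gamma>"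


section \<open>Measures and function spaces\<close>

text \<open>
  On a locally compact separable metric space, a Borel measure that is finite on compact sets is
  automatically regular.
\<close>

definition radon_measure :: "'a::topological_space measure \<Rightarrow> bool" where
  "radon_measure m \<longleftrightarrow> sets m = sets borel \<and> (\<forall>K. compact K \<longrightarrow> emeasure m K < \<infinity>)"

definition full_support :: "'a::topological_space measure \<Rightarrow> bool" where
  "full_support m \<longleftrightarrow> (\<forall>U. open U \<and> U \<noteq> {} \<longrightarrow> emeasure m U > 0)"

definition bounded_borel :: "('a::topological_space \<Rightarrow> real) set" where
  "bounded_borel = {f. f \<in> borel_measurable borel \<and> bounded (range f)}"

definition bounded_cont :: "('a::topological_space \<Rightarrow> real) set" where
  "bounded_cont = {f. continuous_on UNIV f \<and> bounded (range f)}"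

definition L2 :: "'a measure \<Rightarrow> ('a \<Rightarrow> real) set" where
  "L2 m = {f. f \<in> borel_measurable m \<and> integrable m (\<lambda>x. (f x)\<^sup>2)}"

definition L2_inner :: "'a measure \<Rightarrow> ('a \<Rightarrow> real) \<Rightarrow> ('a \<Rightarrow> real) \<Rightarrow> real" where
  "L2_inner m u v = (\<integral>x. u x * v x \<partial>m)"

definition L2_norm :: "'a measure \<Rightarrow> ('a \<Rightarrow> real) \<Rightarrow> real" where
  "L2_norm m u = sqrt (\<integral>x. (u x)\<^sup>2 \<partial>m)"


section \<open>Symmetry and Class (T)\<close>

text \<open>
  Below, \<open>p\<close> stands for a family of operators such as \<open>semigroup_op X P\<close>. Symmetry is stated for
  nonnegative functions, where both sides make sense in $[0,\infty]$; boundedness of the test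
  functions keeps \<open>p t f\<close> finite.
\<close>

definition symmetric_wrt ::
    "'a::topological_space measure \<Rightarrow> (real \<Rightarrow> ('a \<Rightarrow> real) \<Rightarrow> 'a \<Rightarrow> real) \<Rightarrow> bool" where
  "symmetric_wrt m p \<longleftrightarrow>
     (\<forall>t\<ge>0. \<forall>f\<in>bounded_borel. \<forall>g\<in>bounded_borel. (\<forall>x. f x \<ge> 0) \<and> (\<forall>x. g x \<ge> 0) \<longrightarrow>
        (\<integral>\<^sup>+x. ennreal (p t f x * g x) \<partial>m) = (\<integral>\<^sup>+x. ennreal (f x * p t g x) \<partial>m))"

definition irreducible_wrt ::
    "'a::topological_space measure \<Rightarrow> (real \<Rightarrow> ('a \<Rightarrow> real) \<Rightarrow> 'a \<Rightarrow> real) \<Rightarrow> bool" where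
  "irreducible_wrt m p \<longleftrightarrow>
     (\<forall>A\<in>sets borel.
        (\<forall>f \<in> L2 m \<inter> bounded_borel. \<forall>t>0.
           AE x in m. p t (\<lambda>y. indicator A y * f y) x = indicator A x * p t f x)
        \<longrightarrow> emeasure m A = 0 \<or> emeasure m (UNIV - A) = 0)"

definition strong_feller :: "(real \<Rightarrow> ('a::topological_space \<Rightarrow> real) \<Rightarrow> 'a \<Rightarrow> real) \<Rightarrow> bool" where
  "strong_feller p \<longleftrightarrow> (\<forall>t>0. p t ` bounded_borel \<subseteq> bounded_cont)"

definition tight_process ::
    "(real \<Rightarrow> 'w \<Rightarrow> 'a::topological_space option) \<Rightarrow> ('a option \<Rightarrow> 'w measure) \<Rightarrow> bool" where
  "tight_process X P \<longleftrightarrow>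
     (\<forall>\<epsilon>>0. \<exists>K. compact K \<and> (\<forall>x. resolvent_op X P 1 (indicator (UNIV - K)) x \<le> \<epsilon>))"

definition class_T ::
    "'a::topological_space measure \<Rightarrow> (real \<Rightarrow> 'w \<Rightarrow> 'a option) \<Rightarrow> ('a option \<Rightarrow> 'w measure) \<Rightarrow> bool" where
  "class_T m X P \<longleftrightarrow>
     irreducible_wrt m (semigroup_op X P) \<and> strong_feller (semigroup_op X P) \<and> tight_process X P"


section \<open>Dirichlet form, ground state, intrinsic ultracontractivity\<close>

text \<open>
  The approximating forms with $v = u$ increase as $t$ decreases to $0$, so finiteness of their
  limit is the same as convergence in the reals.
\<close>

definition dirichlet_domain ::
    "'a measure \<Rightarrow> (real \<Rightarrow> ('a \<Rightarrow> real) \<Rightarrow> 'a \<Rightarrow> real) \<Rightarrow> ('a \<Rightarrow> real) set" where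
  "dirichlet_domain m p =
     {u \<in> L2 m. \<exists>l. ((\<lambda>t. 1 / t * L2_inner m (\<lambda>x. u x - p t u x) u) \<longlongrightarrow> l) (at_right 0)}"

definition dirichlet_form ::
    "'a measure \<Rightarrow> (real \<Rightarrow> ('a \<Rightarrow> real) \<Rightarrow> 'a \<Rightarrow> real) \<Rightarrow> ('a \<Rightarrow> real) \<Rightarrow> ('a \<Rightarrow> real) \<Rightarrow> real" where
  "dirichlet_form m p u v = Lim (at_right 0) (\<lambda>t. 1 / t * L2_inner m (\<lambda>x. u x - p t u x) v)"

definition bottom_eigenvalue ::
    "'a measure \<Rightarrow> (real \<Rightarrow> ('a \<Rightarrow> real) \<Rightarrow> 'a \<Rightarrow> real) \<Rightarrow> real" where
  "bottom_eigenvalue m p =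
     Inf {dirichlet_form m p u u | u. u \<in> dirichlet_domain m p \<and> L2_norm m u = 1}"

definition ground_state ::
    "'a measure \<Rightarrow> (real \<Rightarrow> ('a \<Rightarrow> real) \<Rightarrow> 'a \<Rightarrow> real) \<Rightarrow> ('a \<Rightarrow> real) \<Rightarrow> bool" where
  "ground_state m p \<phi> \<longleftrightarrow> \<phi> \<in> dirichlet_domain m p \<and> L2_norm m \<phi> = 1 \<and>
     dirichlet_form m p \<phi> \<phi> = bottom_eigenvalue m p"

definition ground_state_transform ::
    "'a measure \<Rightarrow> (real \<Rightarrow> ('a \<Rightarrow> real) \<Rightarrow> 'a \<Rightarrow> real) \<Rightarrow> ('a \<Rightarrow> real) \<Rightarrow>
     real \<Rightarrow> ('a \<Rightarrow> real) \<Rightarrow> 'a \<Rightarrow> real" where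
  "ground_state_transform m p \<phi> t f x =
     exp (bottom_eigenvalue m p * t) * (1 / \<phi> x) * p t (\<lambda>y. \<phi> y * f y) x"

text \<open>
  For $f \in L^1(\phi^2 m)$ the integral defining the transform converges almost everywhere, because
  the transform of $|f|$ has the finite $\phi^2 m$-integral $\int |f| \phi^2\,dm$.
\<close>

definition intrinsically_ultracontractive ::
    "'a measure \<Rightarrow> (real \<Rightarrow> ('a \<Rightarrow> real) \<Rightarrow> 'a \<Rightarrow> real) \<Rightarrow> ('a \<Rightarrow> real) \<Rightarrow> bool" where
  "intrinsically_ultracontractive m p \<phi> \<longleftrightarrow>
     (let \<mu> = density m (\<lambda>x. ennreal ((\<phi> x)\<^sup>2)) in
      \<forall>t>0. \<exists>c. \<forall>f. integrable \<mu> f \<longrightarrow>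
        (AE x in \<mu>. \<bar>ground_state_transform m p \<phi> t f x\<bar> \<le> c * (\<integral>y. \<bar>f y\<bar> \<partial>\<mu>)))"

definition ground_state_law :: "'a measure \<Rightarrow> ('a \<Rightarrow> real) \<Rightarrow> 'a set \<Rightarrow> real" where
  "ground_state_law m \<phi> B = (LINT x:B|m. \<phi> x) / (\<integral>x. \<phi> x \<partial>m)"

end

theory Submission
  imports Defs
begin

text \<open>
  Let \<open>\<gamma>\<close> be the bottom eigenvalue and \<open>\<phi>\<close> the ground state. The ground state is an eigenfunction,
  $p_t \phi = e^{-\gamma t} \phi$, so that $Q_t f = e^{\gamma t} \phi^{-1} p_t(\phi f)$ is a conservative
  Markov semigroup which is symmetric with respect to the probability measure
  $\mu = \phi^2 m$. If $Q_t g$ tends to $\int g\,d\mu$, then for $g = 1_B / \phi$ this reads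
  $e^{\gamma t} p_t 1_B(x) \to \phi(x) \int_B \phi\,dm$. Integrating over the initial law and dividing
  by the same statement for the whole space gives the theorem, because being alive at time \<open>t\<close> means
  being somewhere in the state space.

  Three points need an argument.

  The eigenvalue relation (\<open>ground_state_eigenfunction\<close>). The ground state is given only as a
  minimizer of the Dirichlet form. Its correlation function $a(t) = (p_t \phi, \phi)$ is log-convex,
  starts with slope \<open>- \<gamma>\<close>, and by minimality decays everywhere at least at rate \<open>\<gamma>\<close>; this forces
  $a(t) = e^{-\gamma t}$ (\<open>log_convex_extremal_is_exponential\<close>) and then the eigenvalue relation.

  Ergodicity (\<open>uniform_ergodicity\<close>). Along an orbit of a symmetric semigroup all squared distances
  are second differences of a decreasing correlation function, so the orbit is Cauchy in $L^2$;
  ultracontractivity makes it uniformly Cauchy. The limit is invariant, and an invariant function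
  is constant by irreducibility. This argument applies to bounded functions.

  Unbounded functions. Since \<open>\<phi>\<close> may tend to \<open>0\<close>, the function $1_B / \phi$ need not be bounded.
  Ergodicity for the indicator of a set \<open>C\<close> on which \<open>\<phi>\<close> is bounded below gives
  $k \phi \le p_t(\phi 1_C)$ for some $t$ and some $k > 0$, and hence $\phi \in L^1(m)$
  (\<open>integrable_\<phi>\<close>), which is to say $1/\phi \in L^1(\mu)$. Then $Q_1(1_B / \phi)$ is bounded by
  ultracontractivity and has the same mean as $1_B / \phi$.
\<close>

section \<open>Log-convex functions on the half-line\<close>

text \<open>
  If the graph rose above a chord, consider the leftmost point at which the excess is largest: the
  excess is strictly smaller to the left of it and no larger to the right, so the midpoint inequality
  fails for two points placed symmetrically around it.
\<close>

lemma continuous_midpoint_imp_convex_on: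
  fixes f :: "real \<Rightarrow> real"
  assumes I: "convex I" and cont: "continuous_on I f"
    and mid: "\<And>x y. x \<in> I \<Longrightarrow> y \<in> I \<Longrightarrow> f ((x + y) / 2) \<le> (f x + f y) / 2"
  shows "convex_on I f"
proof (rule convex_on_linorderI[OF _ I])
  fix t x y :: real
  assume t: "0 < t" "t < 1" and xy: "x \<in> I" "y \<in> I" "x < y"
  define c where "c = (f y - f x) / (y - x)"
  define g where "g z = f z - (f x + c * (z - x))" for z
  have sub: "{x..y} \<subseteq> I"
    using I xy(1,2) by (metis closed_segment_subset closed_segment_eq_real_ivl1 less_imp_le xy(3))
  have gcont: "continuous_on {x..y} g"
    unfolding g_def by (intro continuous_intros continuous_on_subset[OF cont sub])
  have gmid: "g ((u + v) / 2) \<le> (g u + g v) / 2" if "u \<in> {x..y}" "v \<in> {x..y}" for u v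
  proof -
    have "2 * f ((u + v) / 2) \<le> f u + f v" using mid[OF subsetD[OF sub that(1)] subsetD[OF sub that(2)]] by simp
    then show ?thesis by (simp add: g_def field_simps)
  qed
  have gx: "g x = 0" by (simp add: g_def)
  have gy: "g y = 0" using xy by (simp add: g_def c_def)
  obtain z1 where z1: "z1 \<in> {x..y}" and M: "\<And>z. z \<in> {x..y} \<Longrightarrow> g z \<le> g z1"
    using continuous_attains_sup[OF _ _ gcont] xy by auto
  have "g z \<le> 0" if "z \<in> {x..y}" for z
  proof (rule ccontr)
    assume "\<not> g z \<le> 0"
    then have pos: "g z1 > 0" using M[OF that] by linarith
    let ?A = "{x..y} \<inter> g -` {g z1}"
    have "compact ?A"
      unfolding compact_eq_bounded_closed
      using continuous_closed_preimage[OF gcont, of "{g z1}"]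
        bounded_subset[OF bounded_closed_interval[of x y], of ?A] by simp
    moreover have "?A \<noteq> {}" using z1 by auto
    ultimately obtain z0 where z0: "z0 \<in> ?A" and least: "\<And>w. w \<in> ?A \<Longrightarrow> z0 \<le> w"
      using compact_attains_inf[of ?A] by metis
    have gz0: "g z0 = g z1" and z0I: "z0 \<in> {x..y}" using z0 by auto
    have "z0 \<noteq> x" "z0 \<noteq> y" using gz0 pos gx gy by auto
    define d where "d = min (z0 - x) (y - z0)"
    have d: "d > 0" using z0I \<open>z0 \<noteq> x\<close> \<open>z0 \<noteq> y\<close> by (auto simp: d_def)
    have in1: "z0 - d \<in> {x..y}" and in2: "z0 + d \<in> {x..y}" using d z0I by (auto simp: d_def)
    have "g (z0 - d) \<noteq> g z1" using least[of "z0 - d"] in1 d by auto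
    then have "g (z0 - d) < g z1" using M[OF in1] by linarith
    moreover have "g z1 + g z1 \<le> g (z0 - d) + g (z0 + d)"
      using gmid[OF in1 in2] gz0 by simp
    moreover note M[OF in2]
    ultimately show False by linarith
  qed
  then have "g ((1 - t) * x + t * y) \<le> 0"
  proof -
    have "(1 - t) * x + t * y \<in> {x..y}"
      using t xy convexD_alt[of "{x..y}" x y t] by simp
    then show ?thesis using \<open>\<And>z. z \<in> {x..y} \<Longrightarrow> g z \<le> 0\<close> by blast
  qed
  moreover have "f x + c * ((1 - t) * x + t * y - x) = (1 - t) * f x + t * f y"
  proof -
    have "c * ((1 - t) * x + t * y - x) = t * (c * (y - x))" by (simp add: algebra_simps)
    also have "c * (y - x) = f y - f x" using xy by (simp add: c_def)
    finally show ?thesis by (simp add: algebra_simps)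
  qed
  ultimately show "f ((1 - t) *\<^sub>R x + t *\<^sub>R y) \<le> (1 - t) * f x + t * f y"
    by (simp add: g_def)
qed

lemma antimono_tendsto_at_right_0:
  fixes q :: "real \<Rightarrow> real"
  assumes anti: "\<And>s t. 0 < s \<Longrightarrow> s \<le> t \<Longrightarrow> q t \<le> q s" and bound: "\<And>t. 0 < t \<Longrightarrow> q t \<le> C"
  shows "\<exists>l. (q \<longlongrightarrow> l) (at_right 0) \<and> (\<forall>t>0. q t \<le> l)"
proof -
  define l where "l = (SUP t\<in>{0<..}. q t)"
  have bdd: "bdd_above (q ` {0<..})" using bound by (auto intro!: bdd_aboveI)
  have le: "q t \<le> l" if "t > 0" for t
    unfolding l_def using that bdd by (auto intro!: cSUP_upper)
  have "(q \<longlongrightarrow> l) (at_right 0)"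
  proof (rule order_tendstoI)
    fix y assume "y < l"
    then obtain s where s: "s > 0" "y < q s"
      unfolding l_def using bdd by (subst (asm) less_cSUP_iff) auto
    show "\<forall>\<^sub>F x in at_right 0. y < q x"
      unfolding eventually_at_right_field
      by (rule exI[of _ s]) (use s anti in \<open>force intro: less_le_trans\<close>)
  next
    fix y assume "l < y"
    show "\<forall>\<^sub>F x in at_right 0. q x < y"
      unfolding eventually_at_right_field
      by (rule exI[of _ 1]) (use le \<open>l < y\<close> in \<open>force intro: le_less_trans\<close>)
  qed
  then show ?thesis using le by blast
qed

text \<open>
  For a convex function the one-sided difference quotients are monotone, so the limit exists; it is
  minus the right derivative. The sign is chosen so that, for the correlation function of an orbit
  of a semigroup, the limit is the value of the Dirichlet form.
\<close>

lemma convex_on_right_slope: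
  fixes a :: "real \<Rightarrow> real"
  assumes conv: "convex_on {0..} a" and r: "0 < r"
  obtains l where "((\<lambda>t. (a r - a (r + t)) / t) \<longlongrightarrow> l) (at_right 0)"
    and "\<And>s. 0 \<le> s \<Longrightarrow> s < r \<Longrightarrow> l \<le> (a s - a r) / (r - s)"
proof -
  have three: "(a r - a (r + t)) / t \<le> (a s - a r) / (r - s)" if "0 \<le> s" "s < r" "0 < t" for s t
  proof -
    have "(a s - a r) / (s - r) \<le> (a r - a (r + t)) / (r - (r + t))"
      using convex_on_slope_le[OF conv, of s "r + t" r] that by auto
    moreover have "(a s - a r) / (s - r) = - ((a s - a r) / (r - s))"
      by (metis minus_diff_eq minus_divide_right)
    ultimately show ?thesis by simp
  qed
  have "(a r - a (r + t)) / t \<le> (a r - a (r + s)) / s" if "0 < s" "s \<le> t" for s t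
  proof (cases "s = t")
    case False
    then have "(a r - a (r + s)) / (r - (r + s)) \<le> (a r - a (r + t)) / (r - (r + t))"
      using convex_on_slope_le(1)[OF conv, of r "r + t" "r + s"] that r by auto
    then show ?thesis by simp
  qed simp
  then obtain l where l: "((\<lambda>t. (a r - a (r + t)) / t) \<longlongrightarrow> l) (at_right 0)"
    using antimono_tendsto_at_right_0[of "\<lambda>t. (a r - a (r + t)) / t" "(a 0 - a r) / (r - 0)"]
      three[of 0] r by blast
  moreover have "l \<le> (a s - a r) / (r - s)" if "0 \<le> s" "s < r" for s
    by (rule tendsto_upperbound[OF l])
       (use three[OF that] in \<open>auto simp: eventually_at_right_field intro!: exI[of _ 1]\<close>)
  ultimately show ?thesis using that by blast
qed

text \<open>
  A function of the form \<open>a t = \<integral> exp (- s t) d\<rho>(s)\<close>, with \<open>\<rho>\<close> a probability measure of mean \<open>\<gamma>\<close>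
  supported in \<open>[\<gamma>, \<infinity>)\<close>, is exponential, since \<open>\<rho>\<close> must be a point mass. Here this is shown without a
  representing measure. Log-convexity takes the place of Jensen's inequality and yields the lower
  bound, through \<open>a (t / 2^n) ^ (2^n) \<le> a t\<close> and the slope at \<open>0\<close>. The condition on the other right
  slopes takes the place of the support condition; with convexity it yields
  \<open>a r * (1 + \<gamma> * (r - s)) \<le> a s\<close> for \<open>s < r\<close>, and iterating over \<open>n\<close> equal steps and letting
  \<open>n\<close> grow gives the upper bound.
\<close>

lemma log_convex_extremal_is_exponential:
  fixes a :: "real \<Rightarrow> real"
  assumes a0: "a 0 = 1" and nonneg: "\<And>t. 0 \<le> t \<Longrightarrow> 0 \<le> a t"
    and lc: "\<And>s t. 0 \<le> s \<Longrightarrow> 0 \<le> t \<Longrightarrow> (a (s + t))\<^sup>2 \<le> a (2 * s) * a (2 * t)"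
    and cont: "continuous_on {0..} a"
    and lam: "0 \<le> \<gamma>"
    and at0: "((\<lambda>t. (1 - a t) / t) \<longlongrightarrow> \<gamma>) (at_right 0)"
    and slope: "\<And>r l. 0 < r \<Longrightarrow> ((\<lambda>t. (a r - a (r + t)) / t) \<longlongrightarrow> l) (at_right 0) \<Longrightarrow>
                  \<gamma> * a r \<le> l"
    and t: "0 \<le> t"
  shows "a t = exp (- \<gamma> * t)"
proof (cases "t = 0")
  case False
  with t have t0: "t > 0" by simp
  have conv: "convex_on {0..} a"
  proof (rule continuous_midpoint_imp_convex_on[OF _ cont])
    fix x y :: real assume xy: "x \<in> {0..}" "y \<in> {0..}"
    have "(a ((x + y) / 2))\<^sup>2 \<le> a x * a y"
      using lc[of "x / 2" "y / 2"] xy by (auto simp: add_divide_distrib)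
    then have "a ((x + y) / 2) \<le> sqrt (a x * a y)" by (rule real_le_rsqrt)
    also have "\<dots> \<le> (a x + a y) / 2" using arith_geo_mean_sqrt nonneg xy by auto
    finally show "a ((x + y) / 2) \<le> (a x + a y) / 2" .
  qed simp
  have "a t \<le> exp (- \<gamma> * t)"
  proof -
    have step: "a r * (1 + \<gamma> * (r - s)) \<le> a s" if sr: "0 \<le> s" "s < r" for r s
    proof -
      obtain l where "((\<lambda>t. (a r - a (r + t)) / t) \<longlongrightarrow> l) (at_right 0)"
        and "l \<le> (a s - a r) / (r - s)"
        using convex_on_right_slope[OF conv, of r] sr by (metis le_less_trans)
      then have "\<gamma> * a r \<le> (a s - a r) / (r - s)"
        using slope[of r l] sr by linarith
      then have "\<gamma> * a r * (r - s) \<le> a s - a r" using sr by (simp add: pos_le_divide_eq)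
      then show ?thesis by (simp add: algebra_simps)
    qed
    have it: "a (h * real k) * (1 + \<gamma> * h) ^ k \<le> 1" if h: "h > 0" for h k
    proof (induction k)
      case (Suc k)
      have "a (h * real (Suc k)) * (1 + \<gamma> * h) \<le> a (h * real k)"
        using step[of "h * real k" "h * real (Suc k)"] h by (simp add: algebra_simps)
      then have "a (h * real (Suc k)) * (1 + \<gamma> * h) * (1 + \<gamma> * h) ^ k \<le> a (h * real k) * (1 + \<gamma> * h) ^ k"
        using h lam by (intro mult_right_mono) auto
      then show ?case using Suc by (simp add: mult.assoc)
    qed (simp add: a0)
    have "(\<lambda>n. a t * (1 + (\<gamma> * t) / real n) ^ n) \<longlonglongrightarrow> a t * exp (\<gamma> * t)"
      by (intro tendsto_intros tendsto_exp_limit_sequentially)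
    moreover have "a t * (1 + (\<gamma> * t) / real n) ^ n \<le> 1" if "n \<ge> 1" for n
      using it[of "t / real n" n] t0 that by simp
    ultimately have "a t * exp (\<gamma> * t) \<le> 1"
      by (intro tendsto_upperbound[where F=sequentially]) (auto simp: eventually_sequentially)
    then show ?thesis by (simp add: exp_minus field_simps)
  qed
  moreover have "exp (- \<gamma> * t) \<le> a t"
  proof -
    have low: "1 - \<gamma> * h \<le> a h" if h: "h > 0" for h
    proof -
      have "(1 - a h) / h \<le> \<gamma>"
      proof (rule tendsto_lowerbound[OF at0])
        have "(1 - a h) / h \<le> (1 - a s) / s" if "0 < s" "s < h" for s
          using convex_on_slope_le(1)[OF conv, of 0 h s] that a0 by simp
        then show "\<forall>\<^sub>F s in at_right 0. (1 - a h) / h \<le> (1 - a s) / s"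
          unfolding eventually_at_right_field using h by blast
      qed simp
      then show ?thesis using h by (simp add: field_simps)
    qed
    have pow: "a (t / 2 ^ n) ^ (2 ^ n) \<le> a t" for n
    proof (induction n)
      case (Suc n)
      have "(a (t / 2 ^ Suc n))\<^sup>2 \<le> a (t / 2 ^ n)"
        using lc[of "t / 2 ^ Suc n" 0] t a0 by simp
      then have "((a (t / 2 ^ Suc n))\<^sup>2) ^ (2 ^ n) \<le> a (t / 2 ^ n) ^ (2 ^ n)"
        by (intro power_mono) auto
      then show ?case using Suc by (simp add: power_mult)
    qed simp
    have sub: "filterlim (\<lambda>n::nat. 2 ^ n :: nat) sequentially sequentially"
      by (rule filterlim_subseq) (simp add: strict_mono_def)
    have "(\<lambda>n. (1 + (- \<gamma> * t) / real (2 ^ n)) ^ (2 ^ n)) \<longlonglongrightarrow> exp (- \<gamma> * t)"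
      by (rule filterlim_compose[OF tendsto_exp_limit_sequentially sub])
    moreover have "\<forall>\<^sub>F n in sequentially. (1 + (- \<gamma> * t) / real (2 ^ n)) ^ (2 ^ n) \<le> a t"
    proof -
      have "(\<lambda>n. 1 + (- \<gamma> * t) / real (2 ^ n)) \<longlonglongrightarrow> 1 + 0"
        by (intro tendsto_add tendsto_const
              filterlim_compose[OF lim_const_over_n sub])
      then have "\<forall>\<^sub>F n in sequentially. 0 < 1 + (- \<gamma> * t) / real (2 ^ n)"
        by (intro order_tendstoD) auto
      then show ?thesis
      proof eventually_elim
        case (elim n)
        have "1 + (- \<gamma> * t) / real (2 ^ n) \<le> a (t / 2 ^ n)"
          using low[of "t / 2 ^ n"] t0 by simp
        then have "(1 + (- \<gamma> * t) / real (2 ^ n)) ^ (2 ^ n) \<le> a (t / 2 ^ n) ^ (2 ^ n)"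
          using elim by (intro power_mono) auto
        then show ?case using pow[of n] by linarith
      qed
    qed
    ultimately show ?thesis by (rule tendsto_upperbound) simp
  qed
  ultimately show ?thesis by simp
qed (simp add: a0)

section \<open>Square-integrable functions\<close>

lemma L2_measurable [measurable_dest]: "u \<in> L2 m \<Longrightarrow> u \<in> borel_measurable m"
  by (simp add: L2_def)

lemma L2_mult_integrable:
  assumes "u \<in> L2 m" "v \<in> L2 m"
  shows "integrable m (\<lambda>x. u x * v x)"
proof (rule Bochner_Integration.integrable_bound)
  show "integrable m (\<lambda>x. (u x)\<^sup>2 + (v x)\<^sup>2)" using assms by (auto simp: L2_def)
  show "(\<lambda>x. u x * v x) \<in> borel_measurable m" using assms by (auto simp: L2_def)
  have "\<bar>a * b\<bar> \<le> a\<^sup>2 + b\<^sup>2" for a b :: real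
  proof -
    have "2 * (\<bar>a\<bar> * \<bar>b\<bar>) \<le> a\<^sup>2 + b\<^sup>2"
      using sum_squares_bound[of "\<bar>a\<bar>" "\<bar>b\<bar>"] by (simp add: mult.assoc)
    moreover have "0 \<le> \<bar>a\<bar> * \<bar>b\<bar>" by simp
    ultimately show ?thesis unfolding abs_mult by linarith
  qed
  then show "AE x in m. norm (u x * v x) \<le> norm ((u x)\<^sup>2 + (v x)\<^sup>2)"
    by (intro AE_I2) simp
qed

lemma L2_diff:
  assumes "u \<in> L2 m" "v \<in> L2 m"
  shows "(\<lambda>x. u x - v x) \<in> L2 m"
proof -
  have "integrable m (\<lambda>x. (u x)\<^sup>2 + (v x)\<^sup>2 - 2 * (u x * v x))"
    using assms L2_mult_integrable[OF assms]
    by (auto simp: L2_def)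
  then show ?thesis using assms by (auto simp: L2_def power2_diff mult.assoc)
qed

lemma L2_scale: "u \<in> L2 m \<Longrightarrow> (\<lambda>x. c * u x) \<in> L2 m"
  by (auto simp: L2_def power_mult_distrib)

lemma L2_inner_cong:
  "(\<And>x. x \<in> space m \<Longrightarrow> u x = u' x) \<Longrightarrow> (\<And>x. x \<in> space m \<Longrightarrow> v x = v' x) \<Longrightarrow>
    L2_inner m u v = L2_inner m u' v'"
  unfolding L2_inner_def by (intro Bochner_Integration.integral_cong) auto

lemma L2_inner_commute: "L2_inner m u v = L2_inner m v u"
  by (simp add: L2_inner_def mult.commute)

lemma L2_inner_diff_left:
  "u \<in> L2 m \<Longrightarrow> v \<in> L2 m \<Longrightarrow> w \<in> L2 m \<Longrightarrow>
    L2_inner m (\<lambda>x. u x - v x) w = L2_inner m u w - L2_inner m v w"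
  by (simp add: L2_inner_def left_diff_distrib L2_mult_integrable)

lemma L2_inner_diff_right:
  "u \<in> L2 m \<Longrightarrow> v \<in> L2 m \<Longrightarrow> w \<in> L2 m \<Longrightarrow>
    L2_inner m w (\<lambda>x. u x - v x) = L2_inner m w u - L2_inner m w v"
  by (simp add: L2_inner_def right_diff_distrib L2_mult_integrable)

lemma L2_inner_scale_left: "L2_inner m (\<lambda>x. c * u x) v = c * L2_inner m u v"
  by (simp add: L2_inner_def mult.assoc)

lemma L2_inner_scale_right: "L2_inner m v (\<lambda>x. c * u x) = c * L2_inner m v u"
  by (simp add: L2_inner_def mult.left_commute)

lemma L2_inner_self_nonneg: "0 \<le> L2_inner m u u"
  by (simp add: L2_inner_def)

lemma L2_norm_eq: "L2_norm m u = sqrt (L2_inner m u u)"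
  by (simp add: L2_norm_def L2_inner_def power2_eq_square)

lemma L2_inner_diff_self:
  assumes "u \<in> L2 m" "v \<in> L2 m"
  shows "L2_inner m (\<lambda>x. u x - v x) (\<lambda>x. u x - v x) =
    L2_inner m u u - 2 * L2_inner m u v + L2_inner m v v"
  using assms
  by (simp add: L2_inner_diff_left L2_inner_diff_right L2_diff L2_inner_commute[of m v u])

lemma L2_Cauchy_Schwarz:
  assumes u: "u \<in> L2 m" and v: "v \<in> L2 m"
  shows "(L2_inner m u v)\<^sup>2 \<le> L2_inner m u u * L2_inner m v v"
proof -
  let ?a = "L2_inner m u u" and ?b = "L2_inner m u v" and ?c = "L2_inner m v v"
  have quad: "0 \<le> ?a - 2 * r * ?b + r\<^sup>2 * ?c" for r
    using L2_inner_self_nonneg[of m "\<lambda>x. u x - r * v x"] L2_inner_diff_self[OF u L2_scale[OF v, of r]]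
    by (simp add: L2_inner_scale_left L2_inner_scale_right power2_eq_square mult.assoc)
  show ?thesis
  proof (cases "?c = 0")
    case True
    have "?b = 0"
    proof (rule ccontr)
      assume "?b \<noteq> 0"
      then show False using quad[of "(?a + 1) / (2 * ?b)"] True by (simp add: field_simps)
    qed
    then show ?thesis using True by simp
  next
    case False
    then have c: "?c > 0" using L2_inner_self_nonneg[of m v] by linarith
    then have "0 \<le> ?a - ?b\<^sup>2 / ?c"
      using quad[of "?b / ?c"] by (simp add: power2_eq_square field_simps)
    then show ?thesis using c by (simp add: field_simps)
  qed
qed

lemma L2_inner_abs_le:
  assumes "u \<in> L2 m" "v \<in> L2 m" "L2_inner m v v \<le> L2_inner m u u"
  shows "\<bar>L2_inner m v u\<bar> \<le> L2_inner m u u"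
proof (rule abs_le_square_iff[THEN iffD2, of _ "L2_inner m u u", simplified abs_of_nonneg[OF L2_inner_self_nonneg]])
  have "(L2_inner m v u)\<^sup>2 \<le> L2_inner m v v * L2_inner m u u"
    by (rule L2_Cauchy_Schwarz[OF assms(2,1)])
  also have "\<dots> \<le> L2_inner m u u * L2_inner m u u"
    using assms(3) L2_inner_self_nonneg by (intro mult_right_mono)
  finally show "(L2_inner m v u)\<^sup>2 \<le> (L2_inner m u u)\<^sup>2" by (simp add: power2_eq_square)
qed

section \<open>Symmetric sub-Markov semigroups\<close>

text \<open>
  Boundedness makes the integrals against sub-probability kernels exist at every point, so that the
  semigroup law and linearity hold everywhere and not only almost everywhere.
\<close>

definition bounded_L2 :: "'a measure \<Rightarrow> ('a \<Rightarrow> real) set" where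
  "bounded_L2 m = {f \<in> L2 m. \<exists>C. \<forall>x\<in>space m. \<bar>f x\<bar> \<le> C}"

lemma bounded_L2_L2: "f \<in> bounded_L2 m \<Longrightarrow> f \<in> L2 m"
  by (simp add: bounded_L2_def)

lemma bounded_L2E:
  assumes "f \<in> bounded_L2 m"
  obtains C where "\<And>x. x \<in> space m \<Longrightarrow> \<bar>f x\<bar> \<le> C"
  using assms unfolding bounded_L2_def by blast

lemma bounded_L2_measurable: "f \<in> bounded_L2 m \<Longrightarrow> f \<in> borel_measurable m"
  by (simp add: bounded_L2_def L2_def)

text \<open>
  Symmetry is stated for functions with values in \<open>[0, \<infinity>]\<close>, where no integrability is at stake; it
  says that \<open>m(dx) K t x (dy)\<close> is a symmetric measure.
\<close>

locale symmetric_submarkov_semigroup =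
  fixes m :: "'a measure" and K :: "real \<Rightarrow> 'a \<Rightarrow> 'a measure"
  assumes kernel: "0 \<le> t \<Longrightarrow> K t \<in> m \<rightarrow>\<^sub>M subprob_algebra m"
    and chapman_kolmogorov: "0 \<le> s \<Longrightarrow> 0 \<le> t \<Longrightarrow> x \<in> space m \<Longrightarrow> K (s + t) x = K t x \<bind> K s"
    and kernel_0: "x \<in> space m \<Longrightarrow> K 0 x = return m x"
    and nn_symmetric: "0 \<le> t \<Longrightarrow> f \<in> borel_measurable m \<Longrightarrow> g \<in> borel_measurable m \<Longrightarrow>
          (\<integral>\<^sup>+x. (\<integral>\<^sup>+y. f y \<partial>K t x) * g x \<partial>m) = (\<integral>\<^sup>+x. f x * (\<integral>\<^sup>+y. g y \<partial>K t x) \<partial>m)"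
begin

definition act :: "real \<Rightarrow> ('a \<Rightarrow> real) \<Rightarrow> 'a \<Rightarrow> real" where
  "act t f x = (\<integral>y. f y \<partial>K t x)"

lemma sets_K: "0 \<le> t \<Longrightarrow> x \<in> space m \<Longrightarrow> sets (K t x) = sets m"
  by (rule sets_kernel[OF kernel])

lemma space_K: "0 \<le> t \<Longrightarrow> x \<in> space m \<Longrightarrow> space (K t x) = space m"
  by (rule sets_eq_imp_space_eq[OF sets_K])

lemma subprob_K: "0 \<le> t \<Longrightarrow> x \<in> space m \<Longrightarrow> subprob_space (K t x)"
  by (rule subprob_space_kernel[OF kernel])

lemma measurable_K: "0 \<le> t \<Longrightarrow> x \<in> space m \<Longrightarrow> f \<in> measurable m N \<Longrightarrow> f \<in> measurable (K t x) N"
  by (subst measurable_cong_sets[OF sets_K refl])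

lemma nn_integral_K_measurable:
  "0 \<le> t \<Longrightarrow> f \<in> borel_measurable m \<Longrightarrow> (\<lambda>x. \<integral>\<^sup>+y. f y \<partial>K t x) \<in> borel_measurable m"
  by (rule measurable_compose[OF kernel nn_integral_measurable_subprob_algebra])

lemma act_measurable:
  "0 \<le> t \<Longrightarrow> f \<in> borel_measurable m \<Longrightarrow> act t f \<in> borel_measurable m"
  unfolding act_def by (rule measurable_compose[OF kernel integral_measurable_subprob_algebra])

lemma integrable_K:
  assumes "0 \<le> t" "x \<in> space m" "f \<in> borel_measurable m" "\<And>y. y \<in> space m \<Longrightarrow> \<bar>f y\<bar> \<le> (C::real)"
  shows "integrable (K t x) f"
proof -
  interpret subprob_space "K t x" by (rule subprob_K) fact+
  show ?thesis
    by (rule integrable_const_bound[where B=C]) (use assms space_K in \<open>auto intro!: measurable_K\<close>)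
qed


lemma nn_integral_K_le:
  assumes t: "0 \<le> t" and f: "f \<in> borel_measurable m"
  shows "(\<integral>\<^sup>+x. (\<integral>\<^sup>+y. f y \<partial>K t x) \<partial>m) \<le> (\<integral>\<^sup>+x. f x \<partial>m)"
proof -
  have "(\<integral>\<^sup>+x. (\<integral>\<^sup>+y. f y \<partial>K t x) \<partial>m) = (\<integral>\<^sup>+x. f x * emeasure (K t x) (space m) \<partial>m)"
    using nn_symmetric[OF t f, of "\<lambda>_. 1"] by (simp add: space_K[OF t] cong: nn_integral_cong)
  also have "\<dots> \<le> (\<integral>\<^sup>+x. f x * 1 \<partial>m)"
    using subprob_space.emeasure_space_le_1[OF subprob_K[OF t]] space_K[OF t]
    by (intro nn_integral_mono mult_left_mono) auto
  finally show ?thesis by simp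
qed

text \<open>
  The estimate covers unbounded functions: if the right-hand side is finite then \<open>f\<close> is integrable
  and the variance-like quantity \<open>\<integral> (f y - act t f x)^2 K t x (dy)\<close> is nonnegative; otherwise there
  is nothing to show. This generality is used for the contraction property on all of $L^2$, over
  which the infimum defining the bottom eigenvalue is taken.
\<close>

lemma act_square_le:
  assumes t: "0 \<le> t" and x: "x \<in> space m" and f: "f \<in> borel_measurable m"
  shows "ennreal ((act t f x)\<^sup>2) \<le> (\<integral>\<^sup>+y. ennreal ((f y)\<^sup>2) \<partial>K t x)"
proof -
  interpret subprob_space "K t x" by (rule subprob_K[OF t x])
  have fm: "f \<in> borel_measurable (K t x)" using measurable_K[OF t x f] .
  show ?thesis
  proof (cases "(\<integral>\<^sup>+y. ennreal ((f y)\<^sup>2) \<partial>K t x) = \<infinity>")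
    case False
    then have sq: "integrable (K t x) (\<lambda>y. (f y)\<^sup>2)"
      using fm by (intro integrableI_nonneg) (auto simp: less_top)
    have i: "integrable (K t x) f"
      by (rule square_integrable_imp_integrable[OF fm sq])
    define c where "c = act t f x"
    have "0 \<le> (\<integral>y. (f y - c)\<^sup>2 \<partial>K t x)" by simp
    also have "\<dots> = (\<integral>y. (f y)\<^sup>2 + c\<^sup>2 - 2 * c * f y \<partial>K t x)"
      by (simp add: power2_diff mult.commute mult.left_commute)
    also have "\<dots> = (\<integral>y. (f y)\<^sup>2 \<partial>K t x) + c\<^sup>2 * measure (K t x) (space (K t x)) - 2 * c * c"
      using i sq by (simp add: c_def act_def)
    also have "\<dots> \<le> (\<integral>y. (f y)\<^sup>2 \<partial>K t x) + c\<^sup>2 * 1 - 2 * c * c"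
      using mult_left_mono[OF subprob_measure_le_1[of "space (K t x)"], of "c\<^sup>2"] by simp
    finally have "c\<^sup>2 \<le> (\<integral>y. (f y)\<^sup>2 \<partial>K t x)" by (simp add: power2_eq_square)
    then show ?thesis
      using nn_integral_eq_integral[OF sq] by (simp add: c_def ennreal_leI)
  qed simp
qed

lemma act_L2:
  assumes t: "0 \<le> t" and u: "u \<in> L2 m"
  shows act_in_L2: "act t u \<in> L2 m"
    and act_contraction: "L2_inner m (act t u) (act t u) \<le> L2_inner m u u"
proof -
  have um: "u \<in> borel_measurable m" and ui: "integrable m (\<lambda>x. (u x)\<^sup>2)"
    using u by (auto simp: L2_def)
  have "(\<integral>\<^sup>+x. ennreal ((act t u x)\<^sup>2) \<partial>m) \<le> (\<integral>\<^sup>+x. (\<integral>\<^sup>+y. ennreal ((u y)\<^sup>2) \<partial>K t x) \<partial>m)"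
    using act_square_le[OF t _ um] by (intro nn_integral_mono) auto
  also have "\<dots> \<le> (\<integral>\<^sup>+x. ennreal ((u x)\<^sup>2) \<partial>m)"
    using um by (intro nn_integral_K_le[OF t]) measurable
  also have "\<dots> = ennreal (\<integral>x. (u x)\<^sup>2 \<partial>m)"
    by (rule nn_integral_eq_integral[OF ui]) simp
  finally have le: "(\<integral>\<^sup>+x. ennreal ((act t u x)\<^sup>2) \<partial>m) \<le> ennreal (\<integral>x. (u x)\<^sup>2 \<partial>m)" .
  have am: "act t u \<in> borel_measurable m" by (rule act_measurable[OF t um])
  then have int: "integrable m (\<lambda>x. (act t u x)\<^sup>2)"
    using le by (intro integrableI_nonneg) (auto simp: less_top[symmetric] top_unique)
  then show "act t u \<in> L2 m" using am by (simp add: L2_def)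
  have "ennreal (\<integral>x. (act t u x)\<^sup>2 \<partial>m) \<le> ennreal (\<integral>x. (u x)\<^sup>2 \<partial>m)"
    using le nn_integral_eq_integral[OF int] by simp
  then show "L2_inner m (act t u) (act t u) \<le> L2_inner m u u"
    by (simp add: L2_inner_def power2_eq_square)
qed

lemma act_abs_le:
  assumes t: "0 \<le> t" and x: "x \<in> space m" and f: "f \<in> borel_measurable m"
    and C: "\<And>y. y \<in> space m \<Longrightarrow> \<bar>f y\<bar> \<le> C"
  shows "\<bar>act t f x\<bar> \<le> C"
proof -
  interpret subprob_space "K t x" by (rule subprob_K[OF t x])
  have C0: "0 \<le> C" using C[OF x] by linarith
  have "\<bar>act t f x\<bar> \<le> (\<integral>y. \<bar>f y\<bar> \<partial>K t x)"
    unfolding act_def by (rule integral_abs_bound)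
  also have "\<dots> \<le> (\<integral>y. C \<partial>K t x)"
    using C space_K[OF t x] integrable_K[OF t x, of "\<lambda>y. \<bar>f y\<bar>" C] f
    by (intro integral_mono) auto
  also have "\<dots> \<le> C * 1"
    using C0 subprob_measure_le_1[of "space (K t x)"] mult_left_mono[of "measure (K t x) (space (K t x))" 1 C] by (simp add: mult.commute)
  finally show ?thesis by simp
qed

lemma act_bounded_L2:
  assumes "0 \<le> t" "f \<in> bounded_L2 m"
  shows "act t f \<in> bounded_L2 m"
  using assms act_in_L2[of t f] act_abs_le[of t _ f] L2_measurable[of f m]
  unfolding bounded_L2_def by blast

lemma act_0:
  assumes "x \<in> space m" "f \<in> borel_measurable m"
  shows "act 0 f x = f x"
  using assms by (simp add: act_def kernel_0 integral_return)

lemma act_act: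
  assumes s: "0 \<le> s" and t: "0 \<le> t" and x: "x \<in> space m"
    and f: "f \<in> borel_measurable m" and C: "\<And>y. y \<in> space m \<Longrightarrow> \<bar>f y\<bar> \<le> C"
  shows "act t (act s f) x = act (s + t) f x"
proof -
  interpret subprob_space "K t x" by (rule subprob_K[OF t x])
  have N: "K s \<in> K t x \<rightarrow>\<^sub>M subprob_algebra m"
    using measurable_K[OF t x kernel[OF s]] .
  have "act (s + t) f x = (\<integral>y. f y \<partial>(K t x \<bind> K s))"
    unfolding act_def by (simp add: chapman_kolmogorov[OF s t x])
  also have "\<dots> = (\<integral>y. (\<integral>z. f z \<partial>K s y) \<partial>K t x)"
  proof (rule integral_bind[OF f C N])
    show "finite_measure (K t x)" by (rule finite_measure_axioms)
    show "AE y in K t x. emeasure (K s y) (space (K s y)) \<le> ennreal 1"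
      using subprob_space.emeasure_space_le_1[OF subprob_K[OF s]] space_K[OF t x]
      by (intro AE_I2) auto
  qed
  finally show ?thesis by (simp add: act_def)
qed

lemma act_diff:
  assumes "0 \<le> t" "x \<in> space m" "f \<in> borel_measurable m" "g \<in> borel_measurable m"
    and "\<And>y. y \<in> space m \<Longrightarrow> \<bar>f y\<bar> \<le> C" "\<And>y. y \<in> space m \<Longrightarrow> \<bar>g y\<bar> \<le> D"
  shows "act t (\<lambda>y. f y - g y) x = act t f x - act t g x"
  unfolding act_def using integrable_K[of t x f C] integrable_K[of t x g D] assms by simp

text \<open>
  For nonnegative functions this is \<open>nn_symmetric\<close>; the general case follows by splitting both
  functions into positive and negative parts.
\<close>

lemma act_symmetric:
  assumes t: "0 \<le> t" and f: "f \<in> bounded_L2 m" and g: "g \<in> bounded_L2 m"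
  shows "L2_inner m (act t f) g = L2_inner m f (act t g)"
proof -
  have pos: "L2_inner m (act t f) g = L2_inner m f (act t g)"
    if f: "f \<in> bounded_L2 m" and g: "g \<in> bounded_L2 m"
      and f0: "\<And>x. 0 \<le> f x" and g0: "\<And>x. 0 \<le> g x" for f g
  proof -
    have nn: "ennreal (act t h x) = (\<integral>\<^sup>+y. ennreal (h y) \<partial>K t x)"
      if h: "h \<in> bounded_L2 m" and h0: "\<And>x. 0 \<le> h x" and x: "x \<in> space m" for h x
    proof -
      obtain C where C: "\<And>y. y \<in> space m \<Longrightarrow> \<bar>h y\<bar> \<le> C" using bounded_L2E[OF h] by metis
      have "integrable (K t x) h"
        by (rule integrable_K[OF t x bounded_L2_measurable[OF h] C])
      then show ?thesis unfolding act_def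
        using nn_integral_eq_integral[of "K t x" h] h0 by simp
    qed
    have a0: "0 \<le> act t h x" if "\<And>x. 0 \<le> h x" for h x
      unfolding act_def using that by simp
    have meas [measurable]: "f \<in> borel_measurable m" "g \<in> borel_measurable m"
        "act t f \<in> borel_measurable m" "act t g \<in> borel_measurable m"
      using f g act_bounded_L2[OF t] by (auto simp: bounded_L2_def L2_def)
    have "L2_inner m (act t f) g = enn2real (\<integral>\<^sup>+x. ennreal (act t f x * g x) \<partial>m)"
      unfolding L2_inner_def using a0[OF f0] g0 by (intro integral_eq_nn_integral) auto
    also have "(\<integral>\<^sup>+x. ennreal (act t f x * g x) \<partial>m)
        = (\<integral>\<^sup>+x. (\<integral>\<^sup>+y. ennreal (f y) \<partial>K t x) * ennreal (g x) \<partial>m)"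
      using nn[OF f f0] a0[OF f0] g0 by (intro nn_integral_cong) (simp add: ennreal_mult)
    also have "\<dots> = (\<integral>\<^sup>+x. ennreal (f x) * (\<integral>\<^sup>+y. ennreal (g y) \<partial>K t x) \<partial>m)"
      by (rule nn_symmetric[OF t]) measurable
    also have "\<dots> = (\<integral>\<^sup>+x. ennreal (f x * act t g x) \<partial>m)"
      using nn[OF g g0] a0[OF g0] f0 by (intro nn_integral_cong) (simp add: ennreal_mult)
    also have "enn2real \<dots> = L2_inner m f (act t g)"
      unfolding L2_inner_def using a0[OF g0] f0 by (intro integral_eq_nn_integral[symmetric]) auto
    finally show ?thesis .
  qed
  define P where "P h x = max 0 (h x)" for h :: "'a \<Rightarrow> real" and x
  define N where "N h x = max 0 (- h x)" for h :: "'a \<Rightarrow> real" and x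
  have PN: "h = (\<lambda>x. P h x - N h x)" for h by (auto simp: P_def N_def)
  have P: "P h \<in> bounded_L2 m" and N: "N h \<in> bounded_L2 m" if h: "h \<in> bounded_L2 m" for h
  proof -
    have hm: "h \<in> borel_measurable m" and hi: "integrable m (\<lambda>x. (h x)\<^sup>2)"
      using h by (auto simp: bounded_L2_def L2_def)
    obtain C where C: "\<And>x. x \<in> space m \<Longrightarrow> \<bar>h x\<bar> \<le> C" using bounded_L2E[OF h] by metis
    have "integrable m (\<lambda>x. (max 0 (h x))\<^sup>2)" "integrable m (\<lambda>x. (max 0 (- h x))\<^sup>2)"
      using hm by (auto intro!: Bochner_Integration.integrable_bound[OF hi] simp: max_def)
    moreover have "\<bar>max 0 (h x)\<bar> \<le> C" "\<bar>max 0 (- h x)\<bar> \<le> C" if "x \<in> space m" for x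
      using C[OF that] by auto
    ultimately show "P h \<in> bounded_L2 m" "N h \<in> bounded_L2 m"
      using hm unfolding bounded_L2_def L2_def P_def[abs_def] N_def[abs_def] by auto
  qed
  have P0: "0 \<le> P h x" and N0: "0 \<le> N h x" for h x by (auto simp: P_def N_def)
  have split: "L2_inner m (act t h) k = L2_inner m (act t (P h)) (P k) - L2_inner m (act t (P h)) (N k)
      - (L2_inner m (act t (N h)) (P k) - L2_inner m (act t (N h)) (N k))"
    if h: "h \<in> bounded_L2 m" and k: "k \<in> bounded_L2 m" for h k
  proof -
    have "act t h x = act t (P h) x - act t (N h) x" if "x \<in> space m" for x
    proof -
      obtain C where "\<And>y. y \<in> space m \<Longrightarrow> \<bar>P h y\<bar> \<le> C" using bounded_L2E[OF P[OF h]] by metis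
      moreover obtain D where "\<And>y. y \<in> space m \<Longrightarrow> \<bar>N h y\<bar> \<le> D" using bounded_L2E[OF N[OF h]] by metis
      ultimately have "act t (\<lambda>y. P h y - N h y) x = act t (P h) x - act t (N h) x"
        using P[OF h] N[OF h] by (intro act_diff[OF t that]) (auto simp: bounded_L2_def L2_def)
      then show ?thesis using PN[of h] by simp
    qed
    then have "L2_inner m (act t h) k
        = L2_inner m (\<lambda>x. act t (P h) x - act t (N h) x) (\<lambda>x. P k x - N k x)"
      using PN[of k] by (intro L2_inner_cong) (auto dest: fun_cong)
    then show ?thesis
      using P N h k act_bounded_L2[OF t]
      by (simp add: L2_inner_diff_left L2_inner_diff_right L2_diff bounded_L2_L2)
  qed
  show ?thesis
    using pos[OF P[OF f] P[OF g] P0 P0] pos[OF P[OF f] N[OF g] P0 N0]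
      pos[OF N[OF f] P[OF g] N0 P0] pos[OF N[OF f] N[OF g] N0 N0]
      split[OF f g] split[OF g f] L2_inner_commute[of m f "act t g"]
      L2_inner_commute[of m "P f"] L2_inner_commute[of m "N f"]
    by simp
qed

text \<open>
  Symmetry moves the first operator across, so the correlation of two points of an orbit depends only
  on the sum of the times. All norms of differences along an orbit are thereby expressed through the
  single function \<open>t \<mapsto> L2_inner m (act t f) f\<close>, which replaces spectral theory below.
\<close>

lemma act_inner_act:
  assumes s: "0 \<le> s" and t: "0 \<le> t" and f: "f \<in> bounded_L2 m"
  shows "L2_inner m (act s f) (act t f) = L2_inner m (act (s + t) f) f"
proof -
  obtain C where C: "\<And>x. x \<in> space m \<Longrightarrow> \<bar>f x\<bar> \<le> C" using bounded_L2E[OF f] by metis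
  have "L2_inner m (act s f) (act t f) = L2_inner m (act t (act s f)) f"
    by (rule act_symmetric[OF t act_bounded_L2[OF s f] f, symmetric])
  also have "\<dots> = L2_inner m (act (s + t) f) f"
    using act_act[OF s t _ _ C] f by (intro L2_inner_cong) (auto simp: bounded_L2_def L2_def)
  finally show ?thesis .
qed

end

section \<open>Ground states are eigenfunctions\<close>

context symmetric_submarkov_semigroup
begin

lemma dirichlet_domain_L2: "u \<in> dirichlet_domain m act \<Longrightarrow> u \<in> L2 m"
  by (simp add: dirichlet_domain_def)

lemma dirichlet_form_eq:
  assumes "((\<lambda>t. 1 / t * L2_inner m (\<lambda>x. u x - act t u x) v) \<longlongrightarrow> l) (at_right 0)"
  shows "dirichlet_form m act u v = l"
  unfolding dirichlet_form_def by (rule tendsto_Lim[OF _ assms]) simp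

lemma dirichlet_form_tendsto:
  assumes "u \<in> dirichlet_domain m act"
  shows "((\<lambda>t. 1 / t * L2_inner m (\<lambda>x. u x - act t u x) u) \<longlongrightarrow> dirichlet_form m act u u) (at_right 0)"
  using assms dirichlet_form_eq[of u u] unfolding dirichlet_domain_def by auto

text \<open>
  The contraction property makes every difference quotient nonnegative; in particular the set whose
  infimum is the bottom eigenvalue is bounded below.
\<close>

lemma dirichlet_form_nonneg:
  assumes u: "u \<in> dirichlet_domain m act"
  shows "0 \<le> dirichlet_form m act u u"
proof (rule tendsto_lowerbound[OF dirichlet_form_tendsto[OF u]])
  note uL = dirichlet_domain_L2[OF u]
  have "0 \<le> 1 / t * L2_inner m (\<lambda>x. u x - act t u x) u" if t: "0 < t" for t
  proof -
    have "L2_inner m (act t u) u \<le> L2_inner m u u"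
      using L2_inner_abs_le[OF uL act_in_L2[OF less_imp_le[OF t] uL] act_contraction[OF less_imp_le[OF t] uL]]
      by linarith
    then show ?thesis
      using t uL act_in_L2[of t u] by (simp add: L2_inner_diff_left)
  qed
  then show "\<forall>\<^sub>F t in at_right 0. 0 \<le> 1 / t * L2_inner m (\<lambda>x. u x - act t u x) u"
    unfolding eventually_at_right_field by (intro exI[of _ 1]) auto
qed simp

lemma bottom_eigenvalue_le:
  assumes u: "u \<in> dirichlet_domain m act"
  shows "bottom_eigenvalue m act * L2_inner m u u \<le> dirichlet_form m act u u"
proof (cases "L2_inner m u u = 0")
  case True
  then show ?thesis using dirichlet_form_nonneg[OF u] by simp
next
  case False
  define N where "N = L2_inner m u u"
  have N: "N > 0" using False L2_inner_self_nonneg[of m u] by (simp add: N_def)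
  define c where "c = 1 / sqrt N"
  have cc: "c * c = 1 / N" using N by (simp add: c_def flip: real_sqrt_mult)
  define v where "v x = c * u x" for x
  have act_v: "act t v x = c * act t u x" for t x
    by (simp add: act_def v_def[abs_def])
  have "(\<lambda>t. 1 / t * L2_inner m (\<lambda>x. v x - act t v x) v)
      = (\<lambda>t. c * c * (1 / t * L2_inner m (\<lambda>x. u x - act t u x) u))"
    unfolding act_v unfolding v_def right_diff_distrib[symmetric] L2_inner_scale_left L2_inner_scale_right
    by (simp add: mult_ac)
  then have lim: "((\<lambda>t. 1 / t * L2_inner m (\<lambda>x. v x - act t v x) v)
      \<longlongrightarrow> c * c * dirichlet_form m act u u) (at_right 0)"
    using tendsto_mult_left[OF dirichlet_form_tendsto[OF u], of "c * c"] by simp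
  have "v \<in> dirichlet_domain m act"
    using lim L2_scale[OF dirichlet_domain_L2[OF u], of c]
    unfolding dirichlet_domain_def v_def[abs_def, symmetric] by auto
  moreover have "L2_norm m v = 1"
    unfolding L2_norm_eq v_def L2_inner_scale_left L2_inner_scale_right
    using N cc by (simp add: N_def[symmetric] flip: mult.assoc)
  ultimately have "bottom_eigenvalue m act \<le> dirichlet_form m act v v"
    unfolding bottom_eigenvalue_def
    by (intro cInf_lower) (auto intro!: bdd_belowI[of _ 0] dirichlet_form_nonneg)
  also have "\<dots> = dirichlet_form m act u u / N"
    unfolding dirichlet_form_eq[OF lim] cc by simp
  finally show ?thesis using N by (simp add: N_def[symmetric] field_simps)
qed

text \<open>
  Let \<open>a t\<close> be the correlation \<open>L2_inner m (act t \<phi>) \<phi>\<close>. It is log-convex by the Cauchy-Schwarz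
  inequality, and minus its right slope at \<open>0\<close> is the Dirichlet form of \<open>\<phi>\<close>, hence the bottom eigenvalue.
  Minus its right slope at \<open>r\<close> is the Dirichlet form of \<open>act (r / 2) \<phi>\<close>, which is at least the bottom
  eigenvalue times \<open>a r\<close>. So \<open>a\<close> is exactly exponential, and expanding the square shows that
  \<open>act t \<phi>\<close> has distance \<open>0\<close> from \<open>exp (- bottom_eigenvalue m act * t) * \<phi>\<close> in $L^2$.
\<close>

theorem ground_state_eigenfunction:
  assumes gs: "ground_state m act \<phi>" and \<phi>: "\<phi> \<in> bounded_L2 m" and t: "0 \<le> t"
  shows "AE x in m. act t \<phi> x = exp (- bottom_eigenvalue m act * t) * \<phi> x"
proof -
  define \<gamma> where "\<gamma> = bottom_eigenvalue m act"
  define a where "a t = L2_inner m (act t \<phi>) \<phi>" for t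
  have dom: "\<phi> \<in> dirichlet_domain m act" and one: "L2_inner m \<phi> \<phi> = 1"
      and \<gamma>: "dirichlet_form m act \<phi> \<phi> = \<gamma>"
    using gs by (auto simp: ground_state_def \<gamma>_def L2_norm_eq)
  note \<phi>L = bounded_L2_L2[OF \<phi>]
  note actL = act_in_L2[OF _ \<phi>L]
  have inner: "L2_inner m (act s \<phi>) (act t \<phi>) = a (s + t)" if "0 \<le> s" "0 \<le> t" for s t
    unfolding a_def by (rule act_inner_act[OF that \<phi>])
  have act0: "L2_inner m (act 0 \<phi>) v = L2_inner m \<phi> v" for v
    using act_0 \<phi>L by (intro L2_inner_cong) (auto simp: L2_def)
  have a0: "a 0 = 1" unfolding a_def act0 one ..
  have nonneg: "0 \<le> a t" if "0 \<le> t" for t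
    using inner[of "t / 2" "t / 2"] L2_inner_self_nonneg[of m "act (t / 2) \<phi>"] that by simp
  have le1: "a t \<le> 1" if "0 \<le> t" for t
    using L2_inner_abs_le[OF \<phi>L actL[OF that] act_contraction[OF that \<phi>L]] by (simp add: one a_def)
  have quot: "1 / t * L2_inner m (\<lambda>x. act s \<phi> x - act t (act s \<phi>) x) (act s \<phi>)
      = (a (2 * s) - a (2 * s + t)) / t" if "0 \<le> s" "0 < t" for s t
  proof -
    obtain C where C: "\<And>x. x \<in> space m \<Longrightarrow> \<bar>\<phi> x\<bar> \<le> C" using bounded_L2E[OF \<phi>] by metis
    have "L2_inner m (\<lambda>x. act s \<phi> x - act t (act s \<phi>) x) (act s \<phi>)
        = L2_inner m (\<lambda>x. act s \<phi> x - act (s + t) \<phi> x) (act s \<phi>)"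
      using act_act[OF that(1) less_imp_le[OF that(2)] _ bounded_L2_measurable[OF \<phi>] C]
      by (intro L2_inner_cong) auto
    also have "\<dots> = a (2 * s) - a (2 * s + t)"
      using that inner[of s s] inner[of "s + t" s] by (simp add: L2_inner_diff_left actL add_ac)
    finally show ?thesis by simp
  qed
  have at0: "((\<lambda>t. (1 - a t) / t) \<longlongrightarrow> \<gamma>) (at_right 0)"
  proof (rule Lim_transform_eventually[OF dirichlet_form_tendsto[OF dom, unfolded \<gamma>]])
    have "1 / t * L2_inner m (\<lambda>x. \<phi> x - act t \<phi> x) \<phi> = (1 - a t) / t" if "0 < t" for t
      using that \<phi>L actL[of t] by (simp add: L2_inner_diff_left one a_def)
    then show "\<forall>\<^sub>F t in at_right 0. 1 / t * L2_inner m (\<lambda>x. \<phi> x - act t \<phi> x) \<phi> = (1 - a t) / t"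
      unfolding eventually_at_right_field by (intro exI[of _ 1]) auto
  qed
  have cont: "continuous_on {0..} a"
  proof -
    \<comment> \<open>Uniform continuity: moving by \<open>h\<close> costs at most the distance between \<open>act h \<phi>\<close> and \<open>\<phi>\<close>.\<close>
    have modulus: "(a (r + h) - a r)\<^sup>2 \<le> 2 * (1 - a h)" if "0 \<le> r" "0 \<le> h" for r h
    proof -
      have "a (r + h) - a r = L2_inner m (\<lambda>x. act h \<phi> x - \<phi> x) (act r \<phi>)"
        using that inner[of h r] L2_inner_commute[of m \<phi> "act r \<phi>"]
        by (simp add: L2_inner_diff_left actL \<phi>L a_def add.commute)
      then have "(a (r + h) - a r)\<^sup>2
          \<le> L2_inner m (\<lambda>x. act h \<phi> x - \<phi> x) (\<lambda>x. act h \<phi> x - \<phi> x) * L2_inner m (act r \<phi>) (act r \<phi>)"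
        using L2_Cauchy_Schwarz[OF L2_diff[OF actL[of h] \<phi>L] actL[of r]] that by simp
      also have "\<dots> = (a (h + h) - 2 * a h + 1) * a (r + r)"
        using that inner[of h h] inner[of r r] one
        by (simp add: L2_inner_diff_self actL \<phi>L a_def)
      also have "\<dots> \<le> (a (h + h) - 2 * a h + 1) * 1"
        using le1[of "r + r"] that inner[of h h] L2_inner_self_nonneg[of m "\<lambda>x. act h \<phi> x - \<phi> x"] one
        by (intro mult_left_mono) (auto simp: L2_inner_diff_self actL \<phi>L a_def)
      also have "\<dots> \<le> 2 * (1 - a h)" using le1[of "h + h"] that by simp
      finally show ?thesis .
    qed
    have "((\<lambda>t. t * ((1 - a t) / t)) \<longlongrightarrow> 0 * \<gamma>) (at_right 0)"
      by (intro tendsto_mult at0) (auto intro!: tendsto_eq_intros)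
    then have lim0: "((\<lambda>t. t * ((1 - a t) / t)) \<longlongrightarrow> 0) (at_right 0)" by simp
    show ?thesis
      unfolding continuous_on_iff
    proof (intro ballI allI impI)
      fix x e :: real assume x: "x \<in> {0..}" and e: "0 < e"
      obtain d where d: "d > 0" and "\<And>h. 0 < h \<Longrightarrow> h < d \<Longrightarrow> h * ((1 - a h) / h) < e\<^sup>2 / 2"
        using order_tendstoD(2)[OF lim0, of "e\<^sup>2 / 2"] e unfolding eventually_at_right_field by auto
      then have small: "1 - a h < e\<^sup>2 / 2" if "0 < h" "h < d" for h
        using that by force
      have close: "\<bar>a (r + h) - a r\<bar> < e" if "0 \<le> r" "0 < h" "h < d" for r h
      proof (rule power_less_imp_less_base[where n=2])
        show "\<bar>a (r + h) - a r\<bar> ^ 2 < e ^ 2"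
          using modulus[of r h] small[of h] that by simp
      qed (use e in simp)
      have "dist (a y) (a x) < e" if y: "y \<in> {0..}" and "dist y x < d" for y
      proof (cases y x rule: linorder_cases)
        case less
        then show ?thesis using close[of y "x - y"] y that(2) by (auto simp: dist_real_def)
      next
        case greater
        then show ?thesis using close[of x "y - x"] x that(2) by (auto simp: dist_real_def)
      qed (use e in simp)
      then show "\<exists>d>0. \<forall>y\<in>{0..}. dist y x < d \<longrightarrow> dist (a y) (a x) < e" using d by blast
    qed
  qed
  have a_exp: "a t = exp (- \<gamma> * t)" if "0 \<le> t" for t
  proof (rule log_convex_extremal_is_exponential[OF a0 nonneg _ cont _ at0 _ that])
    show "(a (s + t))\<^sup>2 \<le> a (2 * s) * a (2 * t)" if "0 \<le> s" "0 \<le> t" for s t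
      using L2_Cauchy_Schwarz[OF actL[OF that(1)] actL[OF that(2)]] that
      by (simp add: inner flip: mult_2)
    show "0 \<le> \<gamma>" using dirichlet_form_nonneg[OF dom] \<gamma> by simp
    fix r l :: real
    assume r: "0 < r" and l: "((\<lambda>t. (a r - a (r + t)) / t) \<longlongrightarrow> l) (at_right 0)"
    \<comment> \<open>Half of the time \<open>r\<close> goes to each side of the inner product.\<close>
    let ?u = "act (r / 2) \<phi>"
    have lim: "((\<lambda>t. 1 / t * L2_inner m (\<lambda>x. ?u x - act t ?u x) ?u) \<longlongrightarrow> l) (at_right 0)"
    proof (rule Lim_transform_eventually[OF l])
      show "\<forall>\<^sub>F t in at_right 0. (a r - a (r + t)) / t = 1 / t * L2_inner m (\<lambda>x. ?u x - act t ?u x) ?u"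
        unfolding eventually_at_right_field using quot[of "r / 2"] r by (intro exI[of _ 1]) auto
    qed
    then have "?u \<in> dirichlet_domain m act"
      using actL[of "r / 2"] r unfolding dirichlet_domain_def by auto
    from bottom_eigenvalue_le[OF this] show "\<gamma> * a r \<le> l"
      using r inner[of "r / 2" "r / 2"] dirichlet_form_eq[OF lim] by (simp add: \<gamma>_def)
  qed
  define c where "c = exp (- \<gamma> * t)"
  have cL: "(\<lambda>x. c * \<phi> x) \<in> L2 m" by (rule L2_scale[OF \<phi>L])
  have "L2_inner m (\<lambda>x. act t \<phi> x - c * \<phi> x) (\<lambda>x. act t \<phi> x - c * \<phi> x)
      = a (t + t) - 2 * (c * a t) + c * (c * 1)"
    using t inner[of t t] one
    by (simp add: L2_inner_diff_self actL cL L2_inner_scale_left L2_inner_scale_right a_def)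
  also have "\<dots> = 0"
    using t by (simp add: a_exp c_def algebra_simps flip: exp_add)
  finally have "(\<integral>x. (act t \<phi> x - c * \<phi> x)\<^sup>2 \<partial>m) = 0"
    by (simp add: L2_inner_def power2_eq_square)
  moreover have "integrable m (\<lambda>x. (act t \<phi> x - c * \<phi> x)\<^sup>2)"
    using L2_diff[OF actL[OF t] cL] by (simp add: L2_def)
  ultimately have "AE x in m. (act t \<phi> x - c * \<phi> x)\<^sup>2 = 0"
    using integral_nonneg_eq_0_iff_AE[of m "\<lambda>x. (act t \<phi> x - c * \<phi> x)\<^sup>2"] by simp
  then show ?thesis by eventually_elim (simp add: c_def \<gamma>_def)
qed

end

section \<open>Ergodicity of ultracontractive Markov semigroups\<close>

text \<open>
  The bound on \<open>act 1\<close> is required at every point, and irreducibility is expressed through the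
  kernels: a set that almost no step enters or leaves is trivial.
\<close>

locale ultracontractive_markov_semigroup = symmetric_submarkov_semigroup m K + prob_space m
  for m :: "'a measure" and K +
  fixes c :: real
  assumes markov: "0 \<le> t \<Longrightarrow> x \<in> space m \<Longrightarrow> emeasure (K t x) (space m) = 1"
    and ultracontractive: "f \<in> bounded_L2 m \<Longrightarrow> x \<in> space m \<Longrightarrow> \<bar>act 1 f x\<bar> \<le> c * (\<integral>y. \<bar>f y\<bar> \<partial>m)"
    and irreducible: "A \<in> sets m \<Longrightarrow> (\<And>t. 0 < t \<Longrightarrow> AE x in m. AE y in K t x. y \<in> A \<longleftrightarrow> x \<in> A) \<Longrightarrow>
          emeasure m A = 0 \<or> emeasure m (space m - A) = 0"
begin

lemma bounded_L2I:
  assumes "f \<in> borel_measurable m" "\<And>x. x \<in> space m \<Longrightarrow> \<bar>f x\<bar> \<le> C"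
  shows "f \<in> bounded_L2 m"
proof -
  have "integrable m (\<lambda>x. (f x)\<^sup>2)"
  proof (rule integrable_const_bound[where B="C\<^sup>2"])
    show "AE x in m. norm ((f x)\<^sup>2) \<le> C\<^sup>2"
      using assms(2) by (intro AE_I2) (simp add: abs_le_square_iff[symmetric] order_trans[OF assms(2) abs_ge_self])
  qed (use assms(1) in measurable)
  then show ?thesis using assms by (auto simp: bounded_L2_def L2_def)
qed

lemma bounded_L2_integrable:
  assumes "f \<in> bounded_L2 m" shows "integrable m f"
proof -
  obtain C where "\<And>x. x \<in> space m \<Longrightarrow> \<bar>f x\<bar> \<le> C" using bounded_L2E[OF assms] by metis
  then show ?thesis
    using bounded_L2_measurable[OF assms] by (intro integrable_const_bound[where B=C]) auto
qed

lemma const_bounded_L2: "(\<lambda>_. b) \<in> bounded_L2 m"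
  by (rule bounded_L2I[of _ "\<bar>b\<bar>"]) auto

lemma diff_bounded_L2:
  assumes f: "f \<in> bounded_L2 m" and g: "g \<in> bounded_L2 m"
  shows "(\<lambda>x. f x - g x) \<in> bounded_L2 m"
proof -
  obtain C where C: "\<And>x. x \<in> space m \<Longrightarrow> \<bar>f x\<bar> \<le> C" using bounded_L2E[OF f] by metis
  obtain D where D: "\<And>x. x \<in> space m \<Longrightarrow> \<bar>g x\<bar> \<le> D" using bounded_L2E[OF g] by metis
  have "\<bar>f x - g x\<bar> \<le> C + D" if "x \<in> space m" for x using C[OF that] D[OF that] by linarith
  then show ?thesis
    using bounded_L2_measurable[OF f] bounded_L2_measurable[OF g]
    by (intro bounded_L2I[of _ "C + D"]) auto
qed

lemma act_bounded_L2_diff: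
  assumes t: "0 \<le> t" and x: "x \<in> space m" and f: "f \<in> bounded_L2 m" and g: "g \<in> bounded_L2 m"
  shows "act t (\<lambda>y. f y - g y) x = act t f x - act t g x"
proof -
  obtain C where C: "\<And>x. x \<in> space m \<Longrightarrow> \<bar>f x\<bar> \<le> C" using bounded_L2E[OF f] by metis
  obtain D where D: "\<And>x. x \<in> space m \<Longrightarrow> \<bar>g x\<bar> \<le> D" using bounded_L2E[OF g] by metis
  show ?thesis
    by (rule act_diff[OF t x bounded_L2_measurable[OF f] bounded_L2_measurable[OF g] C D])
qed

lemma act_act_bounded:
  assumes "0 \<le> s" "0 \<le> t" "x \<in> space m" "f \<in> bounded_L2 m"
  shows "act t (act s f) x = act (s + t) f x"
proof -
  obtain C where C: "\<And>x. x \<in> space m \<Longrightarrow> \<bar>f x\<bar> \<le> C" using bounded_L2E[OF assms(4)] by metis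
  show ?thesis by (rule act_act[OF assms(1-3) bounded_L2_measurable[OF assms(4)] C])
qed

lemma prob_space_K: "0 \<le> t \<Longrightarrow> x \<in> space m \<Longrightarrow> prob_space (K t x)"
  by (rule prob_spaceI) (simp add: space_K markov)

lemma act_const: "0 \<le> t \<Longrightarrow> x \<in> space m \<Longrightarrow> act t (\<lambda>_. b) x = b"
  using prob_space.prob_space[OF prob_space_K, of t x] by (simp add: act_def)

lemma integral_act:
  assumes t: "0 \<le> t" and f: "f \<in> bounded_L2 m"
  shows "(\<integral>x. act t f x \<partial>m) = (\<integral>x. f x \<partial>m)"
proof -
  have "(\<integral>x. act t f x \<partial>m) = L2_inner m f (act t (\<lambda>_. 1))"
    using act_symmetric[OF t f const_bounded_L2[of 1]] by (simp add: L2_inner_def)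
  also have "\<dots> = (\<integral>x. f x \<partial>m)"
    unfolding L2_inner_def by (intro Bochner_Integration.integral_cong) (auto simp: act_const[OF t])
  finally show ?thesis .
qed

lemma c_nonneg: "0 \<le> c"
proof -
  obtain x where "x \<in> space m" using not_empty by auto
  then show ?thesis
    using ultracontractive[OF const_bounded_L2[of 1], of x] act_const[of 1 x 1] prob_space by simp
qed

lemma integral_abs_le_L2:
  assumes f: "f \<in> bounded_L2 m"
  shows "(\<integral>x. \<bar>f x\<bar> \<partial>m) \<le> sqrt (L2_inner m f f)"
proof (rule real_le_rsqrt)
  have "(\<lambda>x. \<bar>f x\<bar>) \<in> L2 m" using bounded_L2_L2[OF f] by (auto simp: L2_def)
  from L2_Cauchy_Schwarz[OF this bounded_L2_L2[OF const_bounded_L2[of 1]]]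
  show "(\<integral>x. \<bar>f x\<bar> \<partial>m)\<^sup>2 \<le> L2_inner m f f"
    using prob_space by (simp add: L2_inner_def)
qed

text \<open>
  The squared distance of two points of an orbit is \<open>a (2 s) - 2 a (s + t) + a (2 t)\<close> for the
  correlation function \<open>a\<close>. As \<open>a\<close> is nonnegative and decreasing it has a limit, and the three
  terms cancel in the limit.
\<close>

lemma orbit_L2_Cauchy:
  assumes f: "f \<in> bounded_L2 m" and e: "0 < e"
  obtains T where "0 \<le> T"
    and "\<And>s t. T \<le> s \<Longrightarrow> T \<le> t \<Longrightarrow>
      L2_inner m (\<lambda>x. act s f x - act t f x) (\<lambda>x. act s f x - act t f x) \<le> e"
proof -
  define a where "a t = L2_inner m (act t f) f" for t
  have inner: "L2_inner m (act s f) (act t f) = a (s + t)" if "0 \<le> s" "0 \<le> t" for s t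
    unfolding a_def by (rule act_inner_act[OF that f])
  have nonneg: "0 \<le> a t" if "0 \<le> t" for t
    using inner[of "t / 2" "t / 2"] L2_inner_self_nonneg[of m "act (t / 2) f"] that by simp
  have anti: "a t \<le> a s" if "0 \<le> s" "s \<le> t" for s t
  proof -
    let ?r = "(t - s) / 2"
    have st: "s / 2 + ?r = t / 2" by (simp add: field_simps)
    have "L2_inner m (act (t / 2) f) (act (t / 2) f)
        = L2_inner m (act ?r (act (s / 2) f)) (act ?r (act (s / 2) f))"
      using act_act_bounded[of "s / 2" ?r _ f] that f st by (intro L2_inner_cong) auto
    also have "\<dots> \<le> L2_inner m (act (s / 2) f) (act (s / 2) f)"
      using that f by (intro act_contraction act_in_L2 bounded_L2_L2) auto
    finally show ?thesis using inner[of "t / 2" "t / 2"] inner[of "s / 2" "s / 2"] that by simp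
  qed
  define L where "L = (INF t\<in>{0..}. a t)"
  have bdd: "bdd_below (a ` {0..})" using nonneg by (auto intro!: bdd_belowI)
  have L: "L \<le> a t" if "0 \<le> t" for t
    unfolding L_def using that bdd by (auto intro!: cINF_lower)
  have "L < L + e / 2" using e by simp
  then obtain T where T: "0 \<le> T" "a T < L + e / 2"
    unfolding L_def using bdd by (subst (asm) cINF_less_iff) auto
  show ?thesis
  proof (rule that[OF T(1)])
    fix s t assume st: "T \<le> s" "T \<le> t"
    have "L2_inner m (\<lambda>x. act s f x - act t f x) (\<lambda>x. act s f x - act t f x)
        = a (s + s) - 2 * a (s + t) + a (t + t)"
      using st T f by (simp add: L2_inner_diff_self act_in_L2 bounded_L2_L2 inner)
    also have "\<dots> \<le> e"
      using anti[of T "s + s"] anti[of T "t + t"] L[of "s + t"] st T by auto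
    finally show "L2_inner m (\<lambda>x. act s f x - act t f x) (\<lambda>x. act s f x - act t f x) \<le> e" .
  qed
qed

text \<open>
  One more unit of time turns the Cauchy property in $L^2$ into a uniform one, because \<open>act 1\<close> maps
  $L^1$ boundedly into the bounded functions.
\<close>

lemma orbit_uniformly_Cauchy:
  assumes f: "f \<in> bounded_L2 m" and e: "0 < e"
  obtains T where "0 \<le> T"
    and "\<And>s t x. T \<le> s \<Longrightarrow> T \<le> t \<Longrightarrow> x \<in> space m \<Longrightarrow> \<bar>act s f x - act t f x\<bar> \<le> e"
proof -
  \<comment> \<open>The denominator \<open>c + 1\<close> stays positive when \<open>c = 0\<close>.\<close>
  have "0 < (e / (c + 1))\<^sup>2" using e c_nonneg by simp
  then obtain T where T: "0 \<le> T" and close: "\<And>s t. T \<le> s \<Longrightarrow> T \<le> t \<Longrightarrow>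
      L2_inner m (\<lambda>x. act s f x - act t f x) (\<lambda>x. act s f x - act t f x) \<le> (e / (c + 1))\<^sup>2"
    using orbit_L2_Cauchy[OF f] by metis
  show ?thesis
  proof (rule that[of "T + 1"])
    fix s t x assume st: "T + 1 \<le> s" "T + 1 \<le> t" and x: "x \<in> space m"
    define g where "g y = act (s - 1) f y - act (t - 1) f y" for y
    have fs: "act (s - 1) f \<in> bounded_L2 m" and ft: "act (t - 1) f \<in> bounded_L2 m"
      using st T f by (auto intro!: act_bounded_L2)
    have g: "g \<in> bounded_L2 m" unfolding g_def by (rule diff_bounded_L2[OF fs ft])
    have "act s f x - act t f x = act 1 g x"
      using st T act_bounded_L2_diff[OF _ x fs ft, of 1] act_act_bounded[OF _ _ x f, of "s - 1" 1]
        act_act_bounded[OF _ _ x f, of "t - 1" 1] by (simp add: g_def[abs_def])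
    then have "\<bar>act s f x - act t f x\<bar> \<le> c * (\<integral>y. \<bar>g y\<bar> \<partial>m)"
      using ultracontractive[OF g x] by simp
    also have "\<dots> \<le> c * sqrt (L2_inner m g g)"
      by (intro mult_left_mono integral_abs_le_L2 g c_nonneg)
    also have "\<dots> \<le> c * sqrt ((e / (c + 1))\<^sup>2)"
      using close[of "s - 1" "t - 1"] st unfolding g_def
      by (intro mult_left_mono c_nonneg real_sqrt_le_mono) auto
    also have "\<dots> = c * e / (c + 1)" using e c_nonneg by simp
    also have "\<dots> \<le> e" using e c_nonneg by (simp add: field_simps)
    finally show "\<bar>act s f x - act t f x\<bar> \<le> e" .
  qed (use T in simp)
qed

text \<open>
  If \<open>h\<close> is invariant, the conditional variance \<open>V z = \<integral> (h y - h z)^2 K t z (dy)\<close> equals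
  \<open>act t (h^2) z - (h z)^2\<close>, which has integral \<open>0\<close>. So a step of the process almost surely does not
  change the value of \<open>h\<close>, and the set where \<open>h\<close> exceeds its mean is one that no step enters or
  leaves. Irreducibility makes \<open>h\<close> equal to its mean almost everywhere, and the bound on \<open>act 1\<close>,
  applied to \<open>h - b\<close>, removes the exceptional null set.
\<close>

lemma invariant_imp_const:
  assumes h: "h \<in> bounded_L2 m" and inv: "\<And>t x. 0 < t \<Longrightarrow> x \<in> space m \<Longrightarrow> act t h x = h x"
    and x: "x \<in> space m"
  shows "h x = (\<integral>y. h y \<partial>m)"
proof -
  define b where "b = (\<integral>y. h y \<partial>m)"
  define A where "A = {y \<in> space m. b < h y}"
  have hm [measurable]: "h \<in> borel_measurable m" by (rule bounded_L2_measurable[OF h])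
  obtain C where C: "\<And>x. x \<in> space m \<Longrightarrow> \<bar>h x\<bar> \<le> C" using bounded_L2E[OF h] by metis
  have sq_le: "\<bar>(h y)\<^sup>2\<bar> \<le> C\<^sup>2" if "y \<in> space m" for y
    using C[OF that] by (simp add: abs_le_square_iff[symmetric] order_trans[OF C[OF that] abs_ge_self])
  have h2: "(\<lambda>y. (h y)\<^sup>2) \<in> bounded_L2 m" by (rule bounded_L2I[OF _ sq_le]) measurable
  have fixed: "AE z in m. AE y in K t z. h y = h z" if t: "0 < t" for t
  proof -
    define V where "V z = (\<integral>y. (h y - h z)\<^sup>2 \<partial>K t z)" for z
    have ih: "integrable (K t z) h" and ih2: "integrable (K t z) (\<lambda>y. (h y)\<^sup>2)"
      if "z \<in> space m" for z
      by (rule integrable_K[OF less_imp_le[OF t] that hm C], assumption)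
         (rule integrable_K[OF less_imp_le[OF t] that bounded_L2_measurable[OF h2] sq_le])
    have V: "V z = act t (\<lambda>y. (h y)\<^sup>2) z - (h z)\<^sup>2" if z: "z \<in> space m" for z
    proof -
      interpret Kz: prob_space "K t z" using prob_space_K t z by simp
      have "V z = (\<integral>y. (h y)\<^sup>2 - 2 * h z * h y + (h z)\<^sup>2 \<partial>K t z)"
        unfolding V_def by (simp add: power2_diff algebra_simps)
      also have "\<dots> = act t (\<lambda>y. (h y)\<^sup>2) z - 2 * h z * act t h z + (h z)\<^sup>2"
        using ih[OF z] ih2[OF z] by (simp add: act_def Kz.prob_space)
      finally show ?thesis using inv[OF t z] by (simp add: power2_eq_square)
    qed
    have Vb: "(\<lambda>z. act t (\<lambda>y. (h y)\<^sup>2) z - (h z)\<^sup>2) \<in> bounded_L2 m"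
      using t h2 by (intro diff_bounded_L2 act_bounded_L2) auto
    have "(\<integral>z. act t (\<lambda>y. (h y)\<^sup>2) z - (h z)\<^sup>2 \<partial>m) = 0"
      using integral_act[OF less_imp_le[OF t] h2] t h2 act_bounded_L2[OF less_imp_le[OF t] h2]
      by (simp add: bounded_L2_integrable)
    moreover have "AE z in m. 0 \<le> act t (\<lambda>y. (h y)\<^sup>2) z - (h z)\<^sup>2"
      by (intro AE_I2) (simp add: V[symmetric] V_def)
    ultimately have "AE z in m. act t (\<lambda>y. (h y)\<^sup>2) z - (h z)\<^sup>2 = 0"
      using integral_nonneg_eq_0_iff_AE[OF bounded_L2_integrable[OF Vb]] by simp
    then show ?thesis
    proof (rule AE_mp[OF _ AE_I2], intro impI)
      fix z assume z: "z \<in> space m" and "act t (\<lambda>y. (h y)\<^sup>2) z - (h z)\<^sup>2 = 0"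
      then have "(\<integral>y. (h y - h z)\<^sup>2 \<partial>K t z) = 0" using V[OF z] by (simp add: V_def)
      moreover have "integrable (K t z) (\<lambda>y. (h y - h z)\<^sup>2)"
      proof -
        interpret Kz: prob_space "K t z" using prob_space_K t z by simp
        have "integrable (K t z) (\<lambda>y. (h y)\<^sup>2 - 2 * h z * h y + (h z)\<^sup>2)"
          using ih[OF z] ih2[OF z] by simp
        then show ?thesis by (simp add: power2_diff algebra_simps)
      qed
      ultimately have "AE y in K t z. (h y - h z)\<^sup>2 = 0"
        using integral_nonneg_eq_0_iff_AE[of "K t z" "\<lambda>y. (h y - h z)\<^sup>2"] by simp
      then show "AE y in K t z. h y = h z" by eventually_elim simp
    qed
  qed
  have "emeasure m A = 0 \<or> emeasure m (space m - A) = 0"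
  proof (rule irreducible)
    show "A \<in> sets m" unfolding A_def by measurable
    fix t :: real assume t: "0 < t"
    show "AE z in m. AE y in K t z. y \<in> A \<longleftrightarrow> z \<in> A"
      using fixed[OF t] AE_space
    proof eventually_elim
      case (elim z)
      have "AE y in K t z. y \<in> space m"
        using space_K[of t z] t elim(2) AE_space[of "K t z"] by simp
      then show ?case using elim(1) by eventually_elim (use elim(2) in \<open>auto simp: A_def\<close>)
    qed
  qed
  then have "AE y in m. h y = b"
  proof
    assume "emeasure m A = 0"
    then have "AE y in m. y \<notin> A" by (intro AE_not_in) (auto simp: A_def null_sets_def)
    then have le: "AE y in m. 0 \<le> b - h y" using AE_space by eventually_elim (auto simp: A_def)
    have "(\<integral>y. b - h y \<partial>m) = 0" using bounded_L2_integrable[OF h] prob_space by (simp add: b_def)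
    then have "AE y in m. b - h y = 0"
      using integral_nonneg_eq_0_iff_AE[of m "\<lambda>y. b - h y"] le bounded_L2_integrable[OF h] by simp
    then show ?thesis by eventually_elim simp
  next
    assume "emeasure m (space m - A) = 0"
    then have "AE y in m. y \<notin> space m - A" by (intro AE_not_in) (auto simp: A_def null_sets_def)
    then have le: "AE y in m. 0 \<le> h y - b" using AE_space by eventually_elim (auto simp: A_def)
    have "(\<integral>y. h y - b \<partial>m) = 0" using bounded_L2_integrable[OF h] prob_space by (simp add: b_def)
    then have "AE y in m. h y - b = 0"
      using integral_nonneg_eq_0_iff_AE[of m "\<lambda>y. h y - b"] le bounded_L2_integrable[OF h] by simp
    then show ?thesis by eventually_elim simp
  qed
  then have "(\<integral>y. \<bar>h y - b\<bar> \<partial>m) = (\<integral>y. 0 \<partial>m)"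
    by (intro integral_cong_AE) auto
  moreover have "\<bar>act 1 (\<lambda>y. h y - b) x\<bar> \<le> c * (\<integral>y. \<bar>h y - b\<bar> \<partial>m)"
    by (rule ultracontractive[OF diff_bounded_L2[OF h const_bounded_L2] x])
  ultimately have "act 1 (\<lambda>y. h y - b) x = 0" by simp
  then show ?thesis
    using act_bounded_L2_diff[OF _ x h const_bounded_L2, of 1 b] act_const[OF _ x, of 1 b] inv[OF _ x, of 1]
    by (simp add: b_def)
qed

text \<open>
  The orbit converges uniformly by the Cauchy property; its limit is invariant and has the mean of
  \<open>f\<close>, hence is that constant.
\<close>

theorem uniform_ergodicity:
  assumes f: "f \<in> bounded_L2 m"
  shows "uniform_limit (space m) (\<lambda>t. act t f) (\<lambda>_. \<integral>y. f y \<partial>m) at_top"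
proof -
  define h where "h x = lim (\<lambda>n. act (real n) f x)" for x
  obtain C where C: "\<And>x. x \<in> space m \<Longrightarrow> \<bar>f x\<bar> \<le> C" using bounded_L2E[OF f] by metis
  have lim: "(\<lambda>n. act (real n) f x) \<longlonglongrightarrow> h x" if x: "x \<in> space m" for x
    unfolding h_def convergent_LIMSEQ_iff[symmetric] Cauchy_convergent_iff[symmetric]
  proof (rule metric_CauchyI)
    fix e :: real assume "0 < e"
    then have "0 < e / 2" by simp
    then obtain T where T: "\<And>s t x. T \<le> s \<Longrightarrow> T \<le> t \<Longrightarrow> x \<in> space m \<Longrightarrow> \<bar>act s f x - act t f x\<bar> \<le> e / 2"
      using orbit_uniformly_Cauchy[OF f] by metis
    obtain N where N: "T \<le> real N" using real_arch_simple by blast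
    have "dist (act (real i) f x) (act (real j) f x) < e" if "N \<le> i" "N \<le> j" for i j
    proof -
      have "T \<le> real i" "T \<le> real j" using that N by linarith+
      from T[OF this x] show ?thesis using \<open>0 < e\<close> by (simp add: dist_real_def)
    qed
    then show "\<exists>M. \<forall>i\<ge>M. \<forall>j\<ge>M. dist (act (real i) f x) (act (real j) f x) < e" by blast
  qed
  have close: "\<exists>T\<ge>0. \<forall>t\<ge>T. \<forall>x\<in>space m. \<bar>act t f x - h x\<bar> \<le> e" if e: "0 < e" for e
  proof -
    obtain T where T0: "0 \<le> T" and T: "\<And>s t x. T \<le> s \<Longrightarrow> T \<le> t \<Longrightarrow> x \<in> space m \<Longrightarrow> \<bar>act s f x - act t f x\<bar> \<le> e"
      using orbit_uniformly_Cauchy[OF f e] by metis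
    obtain N where N: "T \<le> real N" using real_arch_simple by blast
    have "\<bar>act t f x - h x\<bar> \<le> e" if t: "T \<le> t" and x: "x \<in> space m" for t x
    proof (rule tendsto_upperbound)
      show "(\<lambda>n. \<bar>act t f x - act (real n) f x\<bar>) \<longlonglongrightarrow> \<bar>act t f x - h x\<bar>"
        by (intro tendsto_intros lim[OF x])
      have "\<bar>act t f x - act (real n) f x\<bar> \<le> e" if "N \<le> n" for n
        using T[OF t _ x, of "real n"] N that by linarith
      then show "\<forall>\<^sub>F n in sequentially. \<bar>act t f x - act (real n) f x\<bar> \<le> e"
        unfolding eventually_sequentially by blast
    qed simp
    then show ?thesis using T0 by blast
  qed
  have hm: "h \<in> borel_measurable m"
    by (rule borel_measurable_LIMSEQ_real[OF lim])
       (auto intro: act_measurable bounded_L2_measurable[OF f])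
  have "\<bar>h x\<bar> \<le> C" if "x \<in> space m" for x
  proof (rule tendsto_upperbound)
    show "(\<lambda>n. \<bar>act (real n) f x\<bar>) \<longlonglongrightarrow> \<bar>h x\<bar>" by (intro tendsto_intros lim that)
    show "\<forall>\<^sub>F n in sequentially. \<bar>act (real n) f x\<bar> \<le> C"
      using act_abs_le[OF _ that bounded_L2_measurable[OF f] C] by simp
  qed simp
  then have h: "h \<in> bounded_L2 m" by (rule bounded_L2I[OF hm])
  have inv: "act s h x = h x" if s: "0 < s" and x: "x \<in> space m" for s x
  proof (rule eq_iff_diff_eq_0[THEN iffD2], rule ccontr)
    assume "act s h x - h x \<noteq> 0"
    define e where "e = \<bar>act s h x - h x\<bar> / 3"
    have e: "0 < e" using \<open>act s h x - h x \<noteq> 0\<close> by (simp add: e_def)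
    obtain T where T: "0 \<le> T" "\<And>t x. T \<le> t \<Longrightarrow> x \<in> space m \<Longrightarrow> \<bar>act t f x - h x\<bar> \<le> e"
      using close[OF e] by blast
    have fT: "act T f \<in> bounded_L2 m" by (rule act_bounded_L2[OF T(1) f])
    have "\<bar>act s (\<lambda>y. act T f y - h y) x\<bar> \<le> e"
      using T s by (intro act_abs_le[OF _ x] bounded_L2_measurable diff_bounded_L2 fT h) auto
    then have "\<bar>act (T + s) f x - act s h x\<bar> \<le> e"
      using act_bounded_L2_diff[OF _ x fT h, of s] act_act_bounded[OF T(1) _ x f, of s] s by simp
    moreover have "\<bar>act (T + s) f x - h x\<bar> \<le> e" using T(2)[of "T + s" x] s x by simp
    ultimately have "\<bar>act s h x - h x\<bar> \<le> 2 * e" by linarith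
    then show False using e by (simp add: e_def)
  qed
  have mean: "(\<integral>y. h y \<partial>m) = (\<integral>y. f y \<partial>m)"
  proof (rule eq_iff_diff_eq_0[THEN iffD2], rule ccontr)
    assume ne: "(\<integral>y. h y \<partial>m) - (\<integral>y. f y \<partial>m) \<noteq> 0"
    define e where "e = \<bar>(\<integral>y. h y \<partial>m) - (\<integral>y. f y \<partial>m)\<bar> / 2"
    have e: "0 < e" using ne by (simp add: e_def)
    obtain T where T: "0 \<le> T" "\<And>t x. T \<le> t \<Longrightarrow> x \<in> space m \<Longrightarrow> \<bar>act t f x - h x\<bar> \<le> e"
      using close[OF e] by blast
    have fT: "act T f \<in> bounded_L2 m" by (rule act_bounded_L2[OF T(1) f])
    have "\<bar>(\<integral>y. act T f y - h y \<partial>m)\<bar> \<le> (\<integral>y. \<bar>act T f y - h y\<bar> \<partial>m)"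
      by (rule integral_abs_bound)
    also have "\<dots> \<le> (\<integral>y. e \<partial>m)"
      using T bounded_L2_integrable[OF diff_bounded_L2[OF fT h]] by (intro integral_mono) auto
    also have "\<dots> = e" using prob_space by simp
    finally have "\<bar>(\<integral>y. f y \<partial>m) - (\<integral>y. h y \<partial>m)\<bar> \<le> e"
      using integral_act[OF T(1) f] fT h by (simp add: bounded_L2_integrable)
    then show False using e abs_minus_commute[of "\<integral>y. f y \<partial>m" "\<integral>y. h y \<partial>m"]
      unfolding e_def by simp
  qed
  show ?thesis
    unfolding uniform_limit_iff
  proof (intro allI impI)
    fix e :: real assume "0 < e"
    then obtain T where T: "\<And>t x. T \<le> t \<Longrightarrow> x \<in> space m \<Longrightarrow> \<bar>act t f x - h x\<bar> \<le> e / 2"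
      using close[of "e / 2"] by auto
    show "\<forall>\<^sub>F t in at_top. \<forall>x\<in>space m. dist (act t f x) (\<integral>y. f y \<partial>m) < e"
      unfolding eventually_at_top_linorder
    proof (intro exI[of _ T] allI impI ballI)
      fix t x assume "T \<le> t" and x: "x \<in> space m"
      then show "dist (act t f x) (\<integral>y. f y \<partial>m) < e"
        using T[of t x] invariant_imp_const[OF h inv x] mean \<open>0 < e\<close> by (simp add: dist_real_def)
    qed
  qed
qed

end

section \<open>Transition kernels of the killed process\<close>

lemma sets_borel_cemetery:
  "sets (borel_cemetery :: 'a::topological_space option measure) = sigma_sets UNIV {U. openin cemetery_topology U}"
  by (simp add: borel_cemetery_def)

lemma space_borel_cemetery [simp]: "space borel_cemetery = UNIV"
  by (simp add: borel_cemetery_def)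

lemma Some_measurable: "Some \<in> (borel :: 'a::topological_space measure) \<rightarrow>\<^sub>M borel_cemetery"
  unfolding borel_cemetery_def
proof (rule measurable_measure_of)
  fix U :: "'a option set" assume "U \<in> {U. openin cemetery_topology U}"
  then have "openin euclidean {x \<in> topspace (euclidean :: 'a topology). Some x \<in> U}"
    by (intro openin_continuous_map_preimage[OF continuous_map_Some]) auto
  then show "Some -` U \<inter> space borel \<in> sets borel" by (simp add: vimage_def)
qed auto

lemma Some_image_sets:
  assumes "A \<in> sets (borel :: 'a::topological_space measure)"
  shows "Some ` A \<in> sets borel_cemetery"
proof -
  have U: "Some ` (UNIV :: 'a set) \<in> sets borel_cemetery"
    unfolding sets_borel_cemetery by (rule sigma_sets.Basic) simp
  have "A \<in> sigma_sets UNIV {S. open S}" using assms by (simp add: borel_def)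
  then show ?thesis
  proof induction
    case (Basic S)
    then show ?case unfolding sets_borel_cemetery by (intro sigma_sets.Basic) simp
  next
    case (Compl S)
    have "Some ` (UNIV - S) = Some ` UNIV - Some ` S" by auto
    then show ?case using Compl U by (metis sets.Diff)
  next
    case (Union S)
    then show ?case by (simp add: image_UN)
  qed simp
qed

lemma the_measurable: "the \<in> borel_cemetery \<rightarrow>\<^sub>M (borel :: 'a::topological_space measure)"
proof (rule measurableI)
  fix A :: "'a set" assume A: "A \<in> sets borel"
  have "Some ` (UNIV :: 'a set) \<in> sets borel_cemetery" by (rule Some_image_sets) simp
  then have "UNIV - Some ` (UNIV :: 'a set) \<in> sets borel_cemetery"
    using sets.compl_sets[of "Some ` UNIV" borel_cemetery] by simp
  moreover have "the -` A = (if the None \<in> A then Some ` A \<union> (UNIV - Some ` UNIV) else Some ` A)"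
    by (auto simp: image_iff split: if_splits) (metis not_None_eq option.sel)+
  ultimately show "the -` A \<inter> space borel_cemetery \<in> sets borel_cemetery"
    using Some_image_sets[OF A] by auto
qed simp

context markov_process
begin

text \<open>
  The law of the position at time \<open>t\<close> on the event that the process is alive. Discarding the killed
  paths matches the convention that functions on the state space vanish at the cemetery.
\<close>

definition transition_kernel :: "real \<Rightarrow> 'a \<Rightarrow> 'a measure" where
  "transition_kernel t x =
     distr (restrict_space (P (Some x)) {\<omega>. X t \<omega> \<noteq> None}) borel (\<lambda>\<omega>. the (X t \<omega>))"

lemma space_P: "space (P z) = space M"
  by (rule sets_eq_imp_space_eq[OF sets_P])

lemma X_measurable_P: "0 \<le> t \<Longrightarrow> X t \<in> P z \<rightarrow>\<^sub>M borel_cemetery"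
  using measurable_X[of t] by (simp add: measurable_cong_sets[OF sets_P refl])

lemma alive_sets: 
  assumes "0 \<le> t" shows "{\<omega>. X t \<omega> \<noteq> None} \<inter> space (P z) \<in> sets (P z)"
proof -
  have "X t -` Some ` UNIV \<inter> space (P z) \<in> sets (P z)"
    by (rule measurable_sets[OF X_measurable_P[OF assms] Some_image_sets]) simp
  moreover have "X t -` Some ` UNIV = {\<omega>. X t \<omega> \<noteq> None}" by (auto simp: image_iff)
  ultimately show ?thesis by simp
qed

lemma position_measurable:
  "0 \<le> t \<Longrightarrow> (\<lambda>\<omega>. the (X t \<omega>)) \<in> restrict_space (P z) {\<omega>. X t \<omega> \<noteq> None} \<rightarrow>\<^sub>M borel"
  by (intro measurable_restrict_space1 measurable_compose[OF X_measurable_P the_measurable])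

lemma sets_transition_kernel [simp]: "sets (transition_kernel t x) = sets borel"
  and space_transition_kernel [simp]: "space (transition_kernel t x) = UNIV"
  by (simp_all add: transition_kernel_def)

lemma nn_integral_transition_kernel:
  assumes t: "0 \<le> t" and f: "f \<in> borel_measurable borel"
  shows "(\<integral>\<^sup>+y. f y \<partial>transition_kernel t x) = (\<integral>\<^sup>+\<omega>. (case X t \<omega> of None \<Rightarrow> 0 | Some y \<Rightarrow> f y) \<partial>P (Some x))"
proof -
  have "(\<integral>\<^sup>+y. f y \<partial>transition_kernel t x)
      = (\<integral>\<^sup>+\<omega>. f (the (X t \<omega>)) \<partial>restrict_space (P (Some x)) {\<omega>. X t \<omega> \<noteq> None})"
    unfolding transition_kernel_def using f by (intro nn_integral_distr[OF position_measurable[OF t]]) simp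
  also have "\<dots> = (\<integral>\<^sup>+\<omega>. f (the (X t \<omega>)) * indicator {\<omega>. X t \<omega> \<noteq> None} \<omega> \<partial>P (Some x))"
    by (rule nn_integral_restrict_space[OF alive_sets[OF t]])
  also have "\<dots> = (\<integral>\<^sup>+\<omega>. (case X t \<omega> of None \<Rightarrow> 0 | Some y \<Rightarrow> f y) \<partial>P (Some x))"
    by (intro nn_integral_cong) (auto split: option.split)
  finally show ?thesis .
qed

lemma semigroup_op_eq_integral:
  assumes t: "0 \<le> t" and f: "f \<in> borel_measurable borel"
  shows "semigroup_op X P t f x = (\<integral>y. f y \<partial>transition_kernel t x)"
proof -
  have "(\<integral>y. f y \<partial>transition_kernel t x)
      = (\<integral>\<omega>. f (the (X t \<omega>)) \<partial>restrict_space (P (Some x)) {\<omega>. X t \<omega> \<noteq> None})"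
    unfolding transition_kernel_def by (rule integral_distr[OF position_measurable[OF t] f])
  also have "\<dots> = (\<integral>\<omega>. indicator {\<omega>. X t \<omega> \<noteq> None} \<omega> *\<^sub>R f (the (X t \<omega>)) \<partial>P (Some x))"
    by (rule integral_restrict_space[OF alive_sets[OF t]])
  also have "\<dots> = semigroup_op X P t f x"
    unfolding semigroup_op_def ext_cemetery_def
    by (intro Bochner_Integration.integral_cong) (auto split: option.split)
  finally show ?thesis by simp
qed

lemma emeasure_transition_kernel:
  assumes t: "0 \<le> t" and A: "A \<in> sets borel"
  shows "emeasure (transition_kernel t x) A = ennreal (measure (P (Some x)) (X t -` Some ` A \<inter> space M))"
proof -
  interpret prob_space "P (Some x)" by (rule prob_space_P)
  have s: "X t -` Some ` A \<inter> space M \<in> sets (P (Some x))"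
    using measurable_sets[OF X_measurable_P[OF t] Some_image_sets[OF A]] by (simp add: space_P)
  have "emeasure (transition_kernel t x) A = (\<integral>\<^sup>+y. indicator A y \<partial>transition_kernel t x)"
    using A by simp
  also have "\<dots> = (\<integral>\<^sup>+\<omega>. (case X t \<omega> of None \<Rightarrow> 0 | Some y \<Rightarrow> indicator A y) \<partial>P (Some x))"
    using A by (intro nn_integral_transition_kernel[OF t]) simp
  also have "\<dots> = (\<integral>\<^sup>+\<omega>. indicator (X t -` Some ` A \<inter> space M) \<omega> \<partial>P (Some x))"
    by (intro nn_integral_cong) (auto simp: space_P indicator_def image_iff split: option.split)
  also have "\<dots> = ennreal (measure (P (Some x)) (X t -` Some ` A \<inter> space M))"
    using s by (simp add: emeasure_eq_measure)
  finally show ?thesis .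
qed

lemma subprob_transition_kernel:
  assumes "0 \<le> t" shows "subprob_space (transition_kernel t x)"
proof
  interpret prob_space "P (Some x)" by (rule prob_space_P)
  show "emeasure (transition_kernel t x) (space (transition_kernel t x)) \<le> 1"
    using emeasure_transition_kernel[OF assms, of UNIV x] by simp
qed simp

lemma transition_kernel_measurable:
  assumes t: "0 \<le> t" shows "transition_kernel t \<in> borel \<rightarrow>\<^sub>M subprob_algebra borel"
proof (rule measurable_subprob_algebra)
  fix A :: "'a set" assume A: "A \<in> sets borel"
  have "(\<lambda>x. measure (P (Some x)) (X t -` Some ` A \<inter> space M)) \<in> borel_measurable borel"
    by (rule measurable_compose[OF Some_measurable measurable_P[OF t Some_image_sets[OF A]]])
  then show "(\<lambda>x. emeasure (transition_kernel t x) A) \<in> borel_measurable borel"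
    unfolding emeasure_transition_kernel[OF t A] by measurable
qed (auto intro: subprob_transition_kernel[OF t])

text \<open>
  This is the expectation of the Markov property at time \<open>t\<close>; paths that are at the cemetery at time
  \<open>t\<close> contribute nothing because the cemetery is a trap.
\<close>

lemma transition_kernel_Chapman_Kolmogorov:
  assumes s: "0 \<le> s" and t: "0 \<le> t"
  shows "transition_kernel (s + t) x = transition_kernel t x \<bind> transition_kernel s"
proof (rule measure_eqI)
  have Ks: "transition_kernel s \<in> transition_kernel t x \<rightarrow>\<^sub>M subprob_algebra borel"
    using transition_kernel_measurable[OF s] by (simp add: measurable_cong_sets[OF sets_transition_kernel refl])
  show "sets (transition_kernel (s + t) x) = sets (transition_kernel t x \<bind> transition_kernel s)"
    by (subst sets_bind[of _ _ borel]) auto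
  fix A assume "A \<in> sets (transition_kernel (s + t) x)"
  then have A: "A \<in> sets borel" by simp
  let ?F = "natural_filtration M X t" and ?S = "Some ` A"
  let ?G = "\<lambda>z. measure (P z) (X s -` ?S \<inter> space M)"
  note S = Some_image_sets[OF A]
  interpret prob_space "P (Some x)" by (rule prob_space_P)
  have sub: "subalgebra (P (Some x)) ?F"
    unfolding subalgebra_def natural_filtration_def space_P sets_P
  proof (intro conjI)
    let ?C = "{X s -` A \<inter> space M |s A. 0 \<le> s \<and> s \<le> t \<and> A \<in> sets borel_cemetery}"
    have "?C \<subseteq> sets M" using measurable_sets[OF measurable_X] by auto
    then have "sigma_sets (space M) ?C \<subseteq> sets M" by (rule sets.sigma_sets_subset)
    then show "sets (sigma (space M) ?C) \<subseteq> sets M" by (subst sets_measure_of) auto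
    show "space (sigma (space M) ?C) = space M" by (rule space_measure_of) auto
  qed
  have G_meas: "(\<lambda>\<omega>. ?G (X t \<omega>)) \<in> borel_measurable (P (Some x))"
    by (rule measurable_compose[OF X_measurable_P[OF t] measurable_P[OF s S]])
  have G_None: "?G None = 0"
  proof -
    interpret N: prob_space "P None" by (rule prob_space_P)
    have "AE \<omega> in P None. \<omega> \<notin> X s -` ?S \<inter> space M"
      using cemetery_trap[OF s] by eventually_elim auto
    then show ?thesis
      using measurable_sets[OF X_measurable_P[OF s] S, of None]
      by (subst N.prob_eq_0) (auto simp: space_P)
  qed
  have "emeasure (transition_kernel (s + t) x) A = ennreal (measure (P (Some x)) (X (s + t) -` ?S \<inter> space M))"
    using s t by (intro emeasure_transition_kernel A) simp
  also have "measure (P (Some x)) (X (s + t) -` ?S \<inter> space M) = (\<integral>\<omega>. indicator ?S (X (s + t) \<omega>) \<partial>P (Some x))"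
  proof -
    have "(\<integral>\<omega>. indicator ?S (X (s + t) \<omega>) \<partial>P (Some x))
        = (\<integral>\<omega>. indicator (X (s + t) -` ?S \<inter> space M) \<omega> \<partial>P (Some x))"
      by (intro Bochner_Integration.integral_cong) (auto simp: indicator_def space_P)
    also have "\<dots> = measure (P (Some x)) (X (s + t) -` ?S \<inter> space M)"
      by (simp add: space_P Int_absorb2)
    finally show ?thesis by simp
  qed
  also have "\<dots> = (\<integral>\<omega>. ?G (X t \<omega>) \<partial>P (Some x))"
  proof -
    interpret finite_measure_subalgebra "P (Some x)" ?F by unfold_locales (rule sub)
    have ind: "(\<lambda>\<omega>. indicator ?S (X (s + t) \<omega>) :: real) \<in> borel_measurable (P (Some x))"
      using s t S by (intro measurable_compose[OF X_measurable_P]) auto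
    have "integrable (P (Some x)) (\<lambda>\<omega>. indicator ?S (X (s + t) \<omega>) :: real)"
      by (rule integrable_const_bound[where B=1]) (auto simp: indicator_def intro!: ind[unfolded indicator_def])
    then have "(\<integral>\<omega>. indicator ?S (X (s + t) \<omega>) \<partial>P (Some x))
        = (\<integral>\<omega>. real_cond_exp (P (Some x)) ?F (\<lambda>\<omega>'. indicator ?S (X (s + t) \<omega>')) \<omega> \<partial>P (Some x))"
      by (rule real_cond_exp_int(2)[symmetric])
    also have "\<dots> = (\<integral>\<omega>. ?G (X t \<omega>) \<partial>P (Some x))"
      by (intro integral_cong_AE borel_measurable_cond_exp2 G_meas markov_property[OF s t S])
    finally show ?thesis .
  qed
  also have "ennreal \<dots> = (\<integral>\<^sup>+\<omega>. ennreal (?G (X t \<omega>)) \<partial>P (Some x))"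
  proof (rule nn_integral_eq_integral[symmetric])
    show "integrable (P (Some x)) (\<lambda>\<omega>. ?G (X t \<omega>))"
      using prob_space.prob_le_1[OF prob_space_P]
      by (intro integrable_const_bound[where B=1] G_meas) auto
  qed simp
  also have "\<dots> = (\<integral>\<^sup>+\<omega>. (case X t \<omega> of None \<Rightarrow> 0 | Some y \<Rightarrow> ennreal (?G (Some y))) \<partial>P (Some x))"
    using G_None by (intro nn_integral_cong) (auto split: option.split)
  also have "\<dots> = (\<integral>\<^sup>+y. ennreal (?G (Some y)) \<partial>transition_kernel t x)"
    by (intro nn_integral_transition_kernel[OF t, symmetric] measurable_compose[OF _ measurable_ennreal]
          measurable_compose[OF Some_measurable measurable_P[OF s S]])
  also have "\<dots> = (\<integral>\<^sup>+y. emeasure (transition_kernel s y) A \<partial>transition_kernel t x)"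
    by (simp add: emeasure_transition_kernel[OF s A])
  also have "\<dots> = emeasure (transition_kernel t x \<bind> transition_kernel s) A"
    by (rule emeasure_bind[OF _ Ks A, symmetric]) simp
  finally show "emeasure (transition_kernel (s + t) x) A = emeasure (transition_kernel t x \<bind> transition_kernel s) A" .
qed


lemma transition_kernel_0: "transition_kernel 0 x = return borel x"
proof (rule measure_eqI)
  fix A assume "A \<in> sets (transition_kernel 0 x)"
  then have A: "A \<in> sets borel" by simp
  have "emeasure (transition_kernel 0 x) A
      = (\<integral>\<^sup>+\<omega>. (case X 0 \<omega> of None \<Rightarrow> 0 | Some y \<Rightarrow> indicator A y) \<partial>P (Some x))"
    using nn_integral_transition_kernel[of 0 "indicator A" x] A by simp
  also have "\<dots> = (\<integral>\<^sup>+\<omega>. indicator A x \<partial>P (Some x))"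
    using normal[of "Some x"] by (intro nn_integral_cong_AE) auto
  also have "\<dots> = indicator A x"
    using prob_space.emeasure_space_1[OF prob_space_P] by simp
  finally show "emeasure (transition_kernel 0 x) A = emeasure (return borel x) A"
    using A by simp
qed simp

text \<open>
  Symmetry of the process speaks of bounded real functions. Truncating \<open>f\<close> and \<open>g\<close> at integer levels
  and passing to the supremum, first in one and then in the other, extends it to \<open>[0, \<infinity>]\<close>.
\<close>

lemma transition_kernel_nn_symmetric:
  assumes sets_m: "sets m = sets borel" and sym: "symmetric_wrt m (semigroup_op X P)" and t: "0 \<le> t"
    and f: "f \<in> borel_measurable m" and g: "g \<in> borel_measurable m"
  shows "(\<integral>\<^sup>+x. (\<integral>\<^sup>+y. f y \<partial>transition_kernel t x) * g x \<partial>m)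
       = (\<integral>\<^sup>+x. f x * (\<integral>\<^sup>+y. g y \<partial>transition_kernel t x) \<partial>m)"
proof -
  have meas: "h \<in> borel_measurable m \<longleftrightarrow> h \<in> borel_measurable borel" for h :: "'a \<Rightarrow> ennreal"
    by (simp add: measurable_cong_sets[OF sets_m refl])
  let ?K = "\<lambda>h x. \<integral>\<^sup>+y. h y \<partial>transition_kernel t x"
  let ?c = "\<lambda>n h x. min (h x) (of_nat n) :: ennreal"
  have KM: "?K h \<in> borel_measurable borel" if "h \<in> borel_measurable borel" for h
    by (rule measurable_compose[OF transition_kernel_measurable[OF t]
            nn_integral_measurable_subprob_algebra[OF that]])
  have cM: "?c n h \<in> borel_measurable borel" if [measurable]: "h \<in> borel_measurable borel" for h and n :: nat
    by measurable
  have sup: "(SUP n. ?c n h x) = h x" for h and x :: 'a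
  proof -
    have "(SUP n. inf (h x) (of_nat n)) = inf (h x) (SUP n. of_nat n :: ennreal)"
      by (rule inf_SUP[symmetric])
    then show ?thesis by (simp add: ennreal_SUP_of_nat_eq_top inf_min)
  qed
  have inc: "incseq (\<lambda>n x. ?c n h x)" for h :: "'a \<Rightarrow> ennreal"
    by (auto simp: incseq_def le_fun_def min_le_iff_disj intro!: min.mono)
  have bdd: "(\<integral>\<^sup>+x. ?K (?c i f) x * ?c j g x \<partial>m) = (\<integral>\<^sup>+x. ?c i f x * ?K (?c j g) x \<partial>m)"
    if f: "f \<in> borel_measurable borel" and g: "g \<in> borel_measurable borel" for f g and i j :: nat
  proof -
    have real: "\<exists>h'\<in>bounded_borel. (\<forall>x. 0 \<le> h' x) \<and> ?c n h = (\<lambda>x. ennreal (h' x)) \<and>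
        ?K (?c n h) = (\<lambda>x. ennreal (semigroup_op X P t h' x)) \<and> (\<forall>x. 0 \<le> semigroup_op X P t h' x)"
      if h [measurable]: "h \<in> borel_measurable borel" for h :: "'a \<Rightarrow> ennreal" and n :: nat
    proof (intro bexI conjI)
      let ?h = "\<lambda>x. enn2real (?c n h x)"
      have lt: "?c n h x < top" for x by (simp add: min_less_iff_disj of_nat_less_top)
      have le: "?h x \<le> real n" for x
        using enn2real_mono[of "?c n h x" "of_nat n"] by (simp add: of_nat_less_top)
      show eq: "?c n h = (\<lambda>x. ennreal (?h x))" using lt by (auto simp: fun_eq_iff)
      show "\<forall>x. 0 \<le> ?h x" by simp
      have hm: "?h \<in> borel_measurable borel" by measurable
      then show "?h \<in> bounded_borel"
        using le by (auto simp: bounded_borel_def intro!: boundedI[of _ "real n"])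
      show "\<forall>x. 0 \<le> semigroup_op X P t ?h x"
        unfolding semigroup_op_eq_integral[OF t hm] by simp
      have "?K (?c n h) x = ennreal (semigroup_op X P t ?h x)" for x
      proof -
        interpret subprob_space "transition_kernel t x" by (rule subprob_transition_kernel[OF t])
        have "integrable (transition_kernel t x) ?h"
          using le hm by (intro integrable_const_bound[where B="real n"])
             (auto simp: measurable_cong_sets[OF sets_transition_kernel refl])
        then show ?thesis
          unfolding semigroup_op_eq_integral[OF t hm]
          by (subst eq) (rule nn_integral_eq_integral, auto)
      qed
      then show "?K (?c n h) = (\<lambda>x. ennreal (semigroup_op X P t ?h x))" by auto
    qed
    obtain f' where f': "f' \<in> bounded_borel" "\<And>x. 0 \<le> f' x" "?c i f = (\<lambda>x. ennreal (f' x))"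
        "?K (?c i f) = (\<lambda>x. ennreal (semigroup_op X P t f' x))" "\<And>x. 0 \<le> semigroup_op X P t f' x"
      using real[OF f, of i] by metis
    obtain g' where g': "g' \<in> bounded_borel" "\<And>x. 0 \<le> g' x" "?c j g = (\<lambda>x. ennreal (g' x))"
        "?K (?c j g) = (\<lambda>x. ennreal (semigroup_op X P t g' x))" "\<And>x. 0 \<le> semigroup_op X P t g' x"
      using real[OF g, of j] by metis
    have "(\<integral>\<^sup>+x. ennreal (semigroup_op X P t f' x * g' x) \<partial>m)
        = (\<integral>\<^sup>+x. ennreal (f' x * semigroup_op X P t g' x) \<partial>m)"
      using sym t f'(1,2) g'(1,2) unfolding symmetric_wrt_def by blast
    then have "(\<integral>\<^sup>+x. ennreal (semigroup_op X P t f' x) * ennreal (g' x) \<partial>m)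
        = (\<integral>\<^sup>+x. ennreal (f' x) * ennreal (semigroup_op X P t g' x) \<partial>m)"
      using f'(2,5) g'(2,5) by (simp add: ennreal_mult)
    moreover have "?K (?c i f) x * ?c j g x = ennreal (semigroup_op X P t f' x) * ennreal (g' x)"
      "?c i f x * ?K (?c j g) x = ennreal (f' x) * ennreal (semigroup_op X P t g' x)" for x
      using fun_cong[OF f'(3), of x] fun_cong[OF f'(4), of x]
        fun_cong[OF g'(3), of x] fun_cong[OF g'(4), of x] by simp_all
    ultimately show ?thesis by simp
  qed
  have Ksup: "(SUP n. ?K (?c n h) x) = ?K h x" if "h \<in> borel_measurable borel" for h x
  proof -
    have "(\<integral>\<^sup>+y. (SUP n. ?c n h y) \<partial>transition_kernel t x) = (SUP n. ?K (?c n h) x)"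
      by (rule nn_integral_monotone_convergence_SUP[OF inc])
         (use cM[OF that] in \<open>simp add: measurable_cong_sets[OF sets_transition_kernel refl]\<close>)
    then show ?thesis by (simp add: sup)
  qed
  have Kinc: "incseq (\<lambda>n x. ?K (?c n h) x)" for h :: "'a \<Rightarrow> ennreal"
    using inc[of h] by (auto simp: incseq_def le_fun_def intro!: nn_integral_mono)
  have incL: "incseq (\<lambda>n x. U n x * v x)" and incR: "incseq (\<lambda>n x. v x * U n x)"
    if "incseq U" for U :: "nat \<Rightarrow> 'a \<Rightarrow> ennreal" and v
    using that by (auto simp: incseq_def le_fun_def intro!: mult_right_mono mult_left_mono)
  have swap: "(\<integral>\<^sup>+x. (SUP n. U n x) * v x \<partial>m) = (SUP n. \<integral>\<^sup>+x. U n x * v x \<partial>m)"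
    if "incseq U" "\<And>n. U n \<in> borel_measurable borel" "v \<in> borel_measurable borel"
    for U :: "nat \<Rightarrow> 'a \<Rightarrow> ennreal" and v
    unfolding SUP_mult_right_ennreal
    by (rule nn_integral_monotone_convergence_SUP[OF incL[OF that(1)]])
       (use that meas in \<open>auto intro!: borel_measurable_times\<close>)
  have fb: "f \<in> borel_measurable borel" and gb: "g \<in> borel_measurable borel" using f g meas by auto
  have step: "(\<integral>\<^sup>+x. ?K f x * ?c j g x \<partial>m) = (\<integral>\<^sup>+x. f x * ?K (?c j g) x \<partial>m)" for j
    using swap[OF Kinc[of f], of "?c j g"] swap[OF inc[of f], of "?K (?c j g)"]
      bdd[OF fb gb] cM[OF fb] cM[OF gb] KM[OF cM[OF fb]] KM[OF cM[OF gb]]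
    by (simp add: Ksup[OF fb] sup)
  show ?thesis
    using swap[OF inc[of g], of "?K f"] swap[OF Kinc[of g], of f]
      step cM[OF gb] KM[OF fb] KM[OF cM[OF gb]] fb
    by (simp add: Ksup[OF gb] sup mult.commute)
qed

theorem transition_semigroup:
  assumes sets_m: "sets m = sets borel" and sym: "symmetric_wrt m (semigroup_op X P)"
  shows "symmetric_submarkov_semigroup m transition_kernel"
proof
  have sub: "subprob_algebra m = subprob_algebra borel" by (rule subprob_algebra_cong[OF sets_m])
  fix t :: real assume t: "0 \<le> t"
  show "transition_kernel t \<in> m \<rightarrow>\<^sub>M subprob_algebra m"
    unfolding sub measurable_cong_sets[OF sets_m refl] by (rule transition_kernel_measurable[OF t])
  show "transition_kernel (s + t) x = transition_kernel t x \<bind> transition_kernel s" if "0 \<le> s" for s x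
    by (rule transition_kernel_Chapman_Kolmogorov[OF that t])
  show "(\<integral>\<^sup>+x. (\<integral>\<^sup>+y. f y \<partial>transition_kernel t x) * g x \<partial>m)
       = (\<integral>\<^sup>+x. f x * (\<integral>\<^sup>+y. g y \<partial>transition_kernel t x) \<partial>m)"
    if "f \<in> borel_measurable m" "g \<in> borel_measurable m" for f g
    by (rule transition_kernel_nn_symmetric[OF sets_m sym t that])
next
  show "transition_kernel 0 x = return m x" for x
    unfolding transition_kernel_0 by (rule return_cong[OF sets_m, symmetric])
qed

end

section \<open>The Doob transform of a symmetric semigroup\<close>

context symmetric_submarkov_semigroup
begin

text \<open>
  Doob's transform of the kernel by \<open>\<phi>\<close>, with the factor that compensates an exponential decay of
  \<open>\<phi>\<close> under the semigroup. Integrating against it is the ground state transform.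
\<close>

definition doob :: "real \<Rightarrow> ('a \<Rightarrow> real) \<Rightarrow> real \<Rightarrow> 'a \<Rightarrow> 'a measure" where
  "doob \<gamma> \<phi> t x = density (K t x) (\<lambda>y. ennreal (exp (\<gamma> * t) / \<phi> x * \<phi> y))"

context
  fixes \<phi> :: "'a \<Rightarrow> real" and \<gamma> :: real
  assumes \<phi>_meas [measurable]: "\<phi> \<in> borel_measurable m" and \<phi>_pos: "\<And>x. x \<in> space m \<Longrightarrow> 0 < \<phi> x"
begin

lemma sets_doob: "0 \<le> t \<Longrightarrow> x \<in> space m \<Longrightarrow> sets (doob \<gamma> \<phi> t x) = sets m"
  by (simp add: doob_def sets_K)

lemma nn_integral_doob:
  assumes t: "0 \<le> t" and x: "x \<in> space m" and f: "f \<in> borel_measurable m"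
  shows "(\<integral>\<^sup>+y. f y \<partial>doob \<gamma> \<phi> t x)
    = ennreal (exp (\<gamma> * t) / \<phi> x) * (\<integral>\<^sup>+y. ennreal (\<phi> y) * f y \<partial>K t x)"
proof -
  note meas = measurable_K[OF t x]
  have "(\<integral>\<^sup>+y. f y \<partial>doob \<gamma> \<phi> t x) = (\<integral>\<^sup>+y. ennreal (exp (\<gamma> * t) / \<phi> x * \<phi> y) * f y \<partial>K t x)"
    unfolding doob_def using f by (intro nn_integral_density meas) auto
  also have "\<dots> = (\<integral>\<^sup>+y. ennreal (exp (\<gamma> * t) / \<phi> x) * (ennreal (\<phi> y) * f y) \<partial>K t x)"
    using \<phi>_pos[OF x] \<phi>_pos space_K[OF t x]
    by (intro nn_integral_cong, subst ennreal_mult) (auto simp: less_imp_le mult.assoc)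
  also have "\<dots> = ennreal (exp (\<gamma> * t) / \<phi> x) * (\<integral>\<^sup>+y. ennreal (\<phi> y) * f y \<partial>K t x)"
    using f by (intro nn_integral_cmult meas) measurable
  finally show ?thesis .
qed

lemma integral_doob:
  assumes t: "0 \<le> t" and x: "x \<in> space m" and f: "f \<in> borel_measurable m"
  shows "(\<integral>y. f y \<partial>doob \<gamma> \<phi> t x) = exp (\<gamma> * t) / \<phi> x * act t (\<lambda>y. \<phi> y * f y) x"
proof -
  note meas = measurable_K[OF t x]
  have "(\<integral>y. f y \<partial>doob \<gamma> \<phi> t x) = (\<integral>y. (exp (\<gamma> * t) / \<phi> x * \<phi> y) *\<^sub>R f y \<partial>K t x)"
    unfolding doob_def
    using \<phi>_pos[OF x] \<phi>_pos space_K[OF t x]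
    by (intro integral_density meas f AE_I2) (auto simp: less_imp_le)
  also have "\<dots> = (\<integral>y. exp (\<gamma> * t) / \<phi> x * (\<phi> y * f y) \<partial>K t x)"
    by (simp add: mult.assoc)
  finally show ?thesis by (simp add: act_def)
qed

lemma nn_integral_doob_measurable:
  assumes t: "0 \<le> t" and f: "f \<in> borel_measurable m"
  shows "(\<lambda>x. \<integral>\<^sup>+y. f y \<partial>doob \<gamma> \<phi> t x) \<in> borel_measurable m"
proof -
  have [measurable]: "(\<lambda>x. \<integral>\<^sup>+y. ennreal (\<phi> y) * f y \<partial>K t x) \<in> borel_measurable m"
    using f by (intro nn_integral_K_measurable[OF t]) measurable
  have "(\<lambda>x. ennreal (exp (\<gamma> * t) / \<phi> x) * (\<integral>\<^sup>+y. ennreal (\<phi> y) * f y \<partial>K t x)) \<in> borel_measurable m"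
    by measurable
  then show ?thesis
    by (subst measurable_cong[OF nn_integral_doob[OF t _ f]])
qed

lemma emeasure_doob:
  "0 \<le> t \<Longrightarrow> x \<in> space m \<Longrightarrow> A \<in> sets m \<Longrightarrow>
    emeasure (doob \<gamma> \<phi> t x) A = (\<integral>\<^sup>+y. indicator A y \<partial>doob \<gamma> \<phi> t x)"
  by (simp add: sets_doob)

text \<open>
  The eigenvalue relation says precisely that the transformed kernels have mass one. The weights
  \<open>1 / \<phi>\<close> and \<open>\<phi>\<close> at the two ends of a path cancel in the middle of two successive steps, which
  gives the semigroup law, and combine with the density \<open>\<phi>^2\<close> to \<open>\<phi> x * \<phi> y\<close>, which is symmetric.
\<close>

theorem doob_semigroup:
  assumes eigen: "\<And>t x. 0 \<le> t \<Longrightarrow> x \<in> space m \<Longrightarrow>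
    (\<integral>\<^sup>+y. ennreal (\<phi> y) \<partial>K t x) = ennreal (exp (- \<gamma> * t) * \<phi> x)"
  shows "symmetric_submarkov_semigroup (density m (\<lambda>x. ennreal ((\<phi> x)\<^sup>2))) (doob \<gamma> \<phi>)"
    and doob_markov: "\<And>t x. 0 \<le> t \<Longrightarrow> x \<in> space m \<Longrightarrow> emeasure (doob \<gamma> \<phi> t x) (space m) = 1"
proof -
  show total: "emeasure (doob \<gamma> \<phi> t x) (space m) = 1" if t: "0 \<le> t" and x: "x \<in> space m" for t x
  proof -
    have "emeasure (doob \<gamma> \<phi> t x) (space m)
        = ennreal (exp (\<gamma> * t) / \<phi> x) * (\<integral>\<^sup>+y. ennreal (\<phi> y) * indicator (space m) y \<partial>K t x)"
      by (simp add: emeasure_doob[OF t x] nn_integral_doob[OF t x])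
    also have "(\<integral>\<^sup>+y. ennreal (\<phi> y) * indicator (space m) y \<partial>K t x) = (\<integral>\<^sup>+y. ennreal (\<phi> y) \<partial>K t x)"
      using space_K[OF t x] by (intro nn_integral_cong) simp
    also have "ennreal (exp (\<gamma> * t) / \<phi> x) * \<dots> = ennreal (exp (\<gamma> * t) / \<phi> x * (exp (- \<gamma> * t) * \<phi> x))"
      using \<phi>_pos[OF x] by (subst eigen[OF t x], subst ennreal_mult) (auto simp: less_imp_le)
    also have "exp (\<gamma> * t) / \<phi> x * (exp (- \<gamma> * t) * \<phi> x) = 1"
      using \<phi>_pos[OF x] by (simp add: exp_minus field_simps)
    finally show ?thesis by simp
  qed
  let ?\<mu> = "density m (\<lambda>x. ennreal ((\<phi> x)\<^sup>2))"
  have sets_\<mu>: "sets ?\<mu> = sets m" by simp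
  have kern: "doob \<gamma> \<phi> t \<in> m \<rightarrow>\<^sub>M subprob_algebra m" if t: "0 \<le> t" for t
  proof (rule measurable_subprob_algebra)
    fix x assume x: "x \<in> space m"
    have sp: "space (doob \<gamma> \<phi> t x) = space m" by (rule sets_eq_imp_space_eq[OF sets_doob[OF t x]])
    show "subprob_space (doob \<gamma> \<phi> t x)"
      by (rule subprob_spaceI) (use total[OF t x] x in \<open>auto simp: sp\<close>)
    show "sets (doob \<gamma> \<phi> t x) = sets m" by (rule sets_doob[OF t x])
  next
    fix A assume A: "A \<in> sets m"
    show "(\<lambda>x. emeasure (doob \<gamma> \<phi> t x) A) \<in> borel_measurable m"
      by (subst measurable_cong[OF emeasure_doob[OF t _ A]])
         (use A in \<open>auto intro!: nn_integral_doob_measurable[OF t]\<close>)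
  qed
  have sub: "subprob_algebra ?\<mu> = subprob_algebra m" by (rule subprob_algebra_cong[OF sets_\<mu>])
  show "symmetric_submarkov_semigroup ?\<mu> (doob \<gamma> \<phi>)"
  proof
    fix t :: real assume t: "0 \<le> t"
    show "doob \<gamma> \<phi> t \<in> ?\<mu> \<rightarrow>\<^sub>M subprob_algebra ?\<mu>"
      unfolding sub measurable_cong_sets[OF sets_\<mu> refl] by (rule kern[OF t])
    fix f g :: "'a \<Rightarrow> ennreal"
    assume "f \<in> borel_measurable ?\<mu>" "g \<in> borel_measurable ?\<mu>"
    then have [measurable]: "f \<in> borel_measurable m" "g \<in> borel_measurable m" by simp_all
    have side: "(\<integral>\<^sup>+x. (\<integral>\<^sup>+y. u y \<partial>doob \<gamma> \<phi> t x) * v x \<partial>?\<mu>)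
        = ennreal (exp (\<gamma> * t)) * (\<integral>\<^sup>+x. (\<integral>\<^sup>+y. ennreal (\<phi> y) * u y \<partial>K t x) * (ennreal (\<phi> x) * v x) \<partial>m)"
      if [measurable]: "u \<in> borel_measurable m" "v \<in> borel_measurable m" for u v
    proof -
      have [measurable]: "(\<lambda>x. \<integral>\<^sup>+y. ennreal (\<phi> y) * u y \<partial>K t x) \<in> borel_measurable m"
        by (intro nn_integral_K_measurable[OF t]) measurable
      have [measurable]: "(\<lambda>x. \<integral>\<^sup>+y. u y \<partial>doob \<gamma> \<phi> t x) \<in> borel_measurable m"
        by (intro nn_integral_doob_measurable[OF t]) measurable
      have "(\<integral>\<^sup>+x. (\<integral>\<^sup>+y. u y \<partial>doob \<gamma> \<phi> t x) * v x \<partial>?\<mu>)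
          = (\<integral>\<^sup>+x. ennreal ((\<phi> x)\<^sup>2) * ((\<integral>\<^sup>+y. u y \<partial>doob \<gamma> \<phi> t x) * v x) \<partial>m)"
        by (rule nn_integral_density) measurable
      also have "\<dots> = (\<integral>\<^sup>+x. ennreal (exp (\<gamma> * t)) *
            ((\<integral>\<^sup>+y. ennreal (\<phi> y) * u y \<partial>K t x) * (ennreal (\<phi> x) * v x)) \<partial>m)"
      proof (rule nn_integral_cong)
        fix x assume x: "x \<in> space m"
        have "ennreal ((\<phi> x)\<^sup>2) * ennreal (exp (\<gamma> * t) / \<phi> x) = ennreal (exp (\<gamma> * t)) * ennreal (\<phi> x)"
          using \<phi>_pos[OF x] by (simp add: power2_eq_square flip: ennreal_mult)
        then have "ennreal ((\<phi> x)\<^sup>2) * (ennreal (exp (\<gamma> * t) / \<phi> x) * I * v x)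
            = ennreal (exp (\<gamma> * t)) * (I * (ennreal (\<phi> x) * v x))" for I
          by (metis mult.assoc mult.commute)
        then show "ennreal ((\<phi> x)\<^sup>2) * ((\<integral>\<^sup>+y. u y \<partial>doob \<gamma> \<phi> t x) * v x)
            = ennreal (exp (\<gamma> * t)) * ((\<integral>\<^sup>+y. ennreal (\<phi> y) * u y \<partial>K t x) * (ennreal (\<phi> x) * v x))"
          unfolding nn_integral_doob[OF t x that(1)] .
      qed
      also have "\<dots> = ennreal (exp (\<gamma> * t)) * (\<integral>\<^sup>+x. (\<integral>\<^sup>+y. ennreal (\<phi> y) * u y \<partial>K t x) * (ennreal (\<phi> x) * v x) \<partial>m)"
        by (rule nn_integral_cmult) measurable
      finally show ?thesis .
    qed
    have "(\<integral>\<^sup>+x. (\<integral>\<^sup>+y. ennreal (\<phi> y) * f y \<partial>K t x) * (ennreal (\<phi> x) * g x) \<partial>m)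
        = (\<integral>\<^sup>+x. (ennreal (\<phi> x) * f x) * (\<integral>\<^sup>+y. ennreal (\<phi> y) * g y \<partial>K t x) \<partial>m)"
      by (rule nn_symmetric[OF t]) measurable
    then show "(\<integral>\<^sup>+x. (\<integral>\<^sup>+y. f y \<partial>doob \<gamma> \<phi> t x) * g x \<partial>?\<mu>)
        = (\<integral>\<^sup>+x. f x * (\<integral>\<^sup>+y. g y \<partial>doob \<gamma> \<phi> t x) \<partial>?\<mu>)"
      using side[of f g] side[of g f] by (simp add: mult.commute)
  next
    fix s t :: real and x assume s: "0 \<le> s" and t: "0 \<le> t" and "x \<in> space ?\<mu>"
    then have x: "x \<in> space m" by simp
    note st = add_nonneg_nonneg[OF s t]
    have Ks: "K s \<in> K t x \<rightarrow>\<^sub>M subprob_algebra m"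
      using kernel[OF s] by (simp add: measurable_cong_sets[OF sets_K[OF t x] refl])
    have Qs: "doob \<gamma> \<phi> s \<in> doob \<gamma> \<phi> t x \<rightarrow>\<^sub>M subprob_algebra m"
      using kern[OF s] by (simp add: measurable_cong_sets[OF sets_doob[OF t x] refl])
    have sp: "space (doob \<gamma> \<phi> t x) = space m" by (rule sets_eq_imp_space_eq[OF sets_doob[OF t x]])
    show "doob \<gamma> \<phi> (s + t) x = doob \<gamma> \<phi> t x \<bind> doob \<gamma> \<phi> s"
    proof (rule measure_eqI)
      show "sets (doob \<gamma> \<phi> (s + t) x) = sets (doob \<gamma> \<phi> t x \<bind> doob \<gamma> \<phi> s)"
        using x by (subst sets_bind[of _ _ m]) (auto simp: sets_doob s t st sp)
      fix A assume "A \<in> sets (doob \<gamma> \<phi> (s + t) x)"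
      then have A [measurable]: "A \<in> sets m" by (simp add: sets_doob[OF st x])
      let ?I = "\<lambda>y. \<integral>\<^sup>+z. ennreal (\<phi> z) * indicator A z \<partial>K s y"
      have Im: "?I \<in> borel_measurable m" by (rule nn_integral_K_measurable[OF s]) measurable
      have "emeasure (doob \<gamma> \<phi> t x \<bind> doob \<gamma> \<phi> s) A = (\<integral>\<^sup>+y. emeasure (doob \<gamma> \<phi> s y) A \<partial>doob \<gamma> \<phi> t x)"
        by (rule emeasure_bind[OF _ Qs A]) (use x in \<open>auto simp: sp\<close>)
      also have "\<dots> = (\<integral>\<^sup>+y. (\<integral>\<^sup>+z. indicator A z \<partial>doob \<gamma> \<phi> s y) \<partial>doob \<gamma> \<phi> t x)"
        using emeasure_doob[OF s _ A] by (intro nn_integral_cong) (simp add: sp)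
      also have "\<dots> = ennreal (exp (\<gamma> * t) / \<phi> x) *
          (\<integral>\<^sup>+y. ennreal (\<phi> y) * (\<integral>\<^sup>+z. indicator A z \<partial>doob \<gamma> \<phi> s y) \<partial>K t x)"
        by (rule nn_integral_doob[OF t x nn_integral_doob_measurable[OF s]]) measurable
      also have "(\<integral>\<^sup>+y. ennreal (\<phi> y) * (\<integral>\<^sup>+z. indicator A z \<partial>doob \<gamma> \<phi> s y) \<partial>K t x)
          = (\<integral>\<^sup>+y. ennreal (exp (\<gamma> * s)) * ?I y \<partial>K t x)"
      proof (rule nn_integral_cong)
        fix y assume "y \<in> space (K t x)"
        then have y: "y \<in> space m" by (simp add: space_K[OF t x])
        have "ennreal (\<phi> y) * ennreal (exp (\<gamma> * s) / \<phi> y) = ennreal (exp (\<gamma> * s))"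
          using \<phi>_pos[OF y] by (simp flip: ennreal_mult)
        then show "ennreal (\<phi> y) * (\<integral>\<^sup>+z. indicator A z \<partial>doob \<gamma> \<phi> s y) = ennreal (exp (\<gamma> * s)) * ?I y"
          by (subst nn_integral_doob[OF s y]) (auto simp flip: mult.assoc)
      qed
      also have "\<dots> = ennreal (exp (\<gamma> * s)) * (\<integral>\<^sup>+y. ?I y \<partial>K t x)"
        by (rule nn_integral_cmult[OF measurable_K[OF t x Im]])
      also have "(\<integral>\<^sup>+y. ?I y \<partial>K t x) = (\<integral>\<^sup>+z. ennreal (\<phi> z) * indicator A z \<partial>K (s + t) x)"
        unfolding chapman_kolmogorov[OF s t x] by (rule nn_integral_bind[OF _ Ks, symmetric]) measurable
      also have "ennreal (exp (\<gamma> * t) / \<phi> x) * (ennreal (exp (\<gamma> * s)) * (\<integral>\<^sup>+z. ennreal (\<phi> z) * indicator A z \<partial>K (s + t) x))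
          = ennreal (exp (\<gamma> * (s + t)) / \<phi> x) * (\<integral>\<^sup>+z. ennreal (\<phi> z) * indicator A z \<partial>K (s + t) x)"
        using \<phi>_pos[OF x]
        by (simp add: distrib_left exp_add mult_ac flip: mult.assoc ennreal_mult)
      also have "\<dots> = emeasure (doob \<gamma> \<phi> (s + t) x) A"
        unfolding emeasure_doob[OF st x A] by (rule nn_integral_doob[OF st x, symmetric]) measurable
      finally show "emeasure (doob \<gamma> \<phi> (s + t) x) A = emeasure (doob \<gamma> \<phi> t x \<bind> doob \<gamma> \<phi> s) A" ..
    qed
  next
    fix x assume "x \<in> space ?\<mu>"
    then have x: "x \<in> space m" by simp
    show "doob \<gamma> \<phi> 0 x = return ?\<mu> x"
    proof (rule measure_eqI)
      show "sets (doob \<gamma> \<phi> 0 x) = sets (return ?\<mu> x)" using x by (simp add: sets_doob)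
      fix A assume "A \<in> sets (doob \<gamma> \<phi> 0 x)"
      then have A [measurable]: "A \<in> sets m" using x by (simp add: sets_doob)
      have "emeasure (doob \<gamma> \<phi> 0 x) A
          = ennreal (exp (\<gamma> * 0) / \<phi> x) * (\<integral>\<^sup>+y. ennreal (\<phi> y) * indicator A y \<partial>return m x)"
        unfolding emeasure_doob[OF order_refl x A] kernel_0[OF x, symmetric]
        by (rule nn_integral_doob[OF order_refl x]) measurable
      also have "\<dots> = ennreal (1 / \<phi> x) * (ennreal (\<phi> x) * indicator A x)"
        using x by (subst nn_integral_return) auto
      also have "\<dots> = indicator A x"
        using \<phi>_pos[OF x] by (simp flip: mult.assoc ennreal_mult)
      finally show "emeasure (doob \<gamma> \<phi> 0 x) A = emeasure (return ?\<mu> x) A"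
        using A by simp
    qed
  qed
qed

end
end

section \<open>Quasi-stationary limits\<close>

text \<open>
  The Dirichlet form sees the semigroup only for positive times and on $L^2$ functions, which are
  measurable; there the operators of the process are integrals against the transition kernels.
\<close>

lemma ground_state_cong:
  assumes eq: "\<And>t u. 0 < t \<Longrightarrow> u \<in> L2 m \<Longrightarrow> p t u = q t u"
  shows bottom_eigenvalue_cong: "bottom_eigenvalue m p = bottom_eigenvalue m q"
    and "ground_state m p \<phi> \<longleftrightarrow> ground_state m q \<phi>"
proof -
  have lim: "((\<lambda>t. 1 / t * L2_inner m (\<lambda>x. u x - p t u x) u) \<longlongrightarrow> l) (at_right 0) \<longleftrightarrow>
      ((\<lambda>t. 1 / t * L2_inner m (\<lambda>x. u x - q t u x) u) \<longlongrightarrow> l) (at_right 0)" if "u \<in> L2 m" for u l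
    by (rule tendsto_cong) (use eq[OF _ that] in \<open>auto simp: eventually_at_right_field intro!: exI[of _ 1]\<close>)
  have dom: "dirichlet_domain m p = dirichlet_domain m q"
    unfolding dirichlet_domain_def using lim by (intro Collect_cong conj_cong refl) simp
  have form: "dirichlet_form m p u u = dirichlet_form m q u u" if "u \<in> L2 m" for u
    unfolding dirichlet_form_def Topological_Spaces.Lim_def lim[OF that] ..
  have L2: "u \<in> L2 m" if "u \<in> dirichlet_domain m q" for u
    using that by (simp add: dirichlet_domain_def)
  show bot: "bottom_eigenvalue m p = bottom_eigenvalue m q"
    unfolding bottom_eigenvalue_def dom by (intro arg_cong[of _ _ Inf] Collect_cong) (metis form L2)
  show "ground_state m p \<phi> \<longleftrightarrow> ground_state m q \<phi>"
    unfolding ground_state_def dom bot by (auto simp: form L2)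
qed

text \<open>
  The set where the inequality fails is open, so it is empty if it is a null set.
\<close>

lemma full_support_AE_le:
  fixes u v :: "'a::topological_space \<Rightarrow> real"
  assumes m: "sets m = sets borel" "full_support m"
    and cont: "continuous_on UNIV u" "continuous_on UNIV v" and ae: "AE x in m. u x \<le> v x"
  shows "u x \<le> v x"
proof -
  let ?U = "{x. v x < u x}"
  have op: "open ?U" by (rule open_Collect_less[OF cont(2,1)])
  have "emeasure m ?U = 0"
    using ae op m(1) by (subst AE_iff_measurable[symmetric, where P="\<lambda>x. \<not> v x < u x"])
      (auto simp: not_less sets_eq_imp_space_eq[OF m(1)])
  then have "?U = {}" using m(2) op unfolding full_support_def by force
  then show ?thesis by (auto simp: not_less)
qed

locale ultracontractive_process = markov_process M X P
  for M :: "'w measure" and X :: "real \<Rightarrow> 'w \<Rightarrow> 'a::{metric_space, second_countable_topology} option"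
    and P :: "'a option \<Rightarrow> 'w measure" +
  fixes m :: "'a measure" and \<phi> :: "'a \<Rightarrow> real"
  assumes sets_m: "sets m = sets borel" and support: "full_support m"
    and sym: "symmetric_wrt m (semigroup_op X P)"
    and irreducible: "irreducible_wrt m (semigroup_op X P)"
    and strong_feller: "strong_feller (semigroup_op X P)"
    and ground_state: "ground_state m (semigroup_op X P) \<phi>"
    and \<phi>_cont: "\<phi> \<in> bounded_cont" and \<phi>_pos: "0 < \<phi> x"
    and ultracontractive: "intrinsically_ultracontractive m (semigroup_op X P) \<phi>"
begin

sublocale symmetric_submarkov_semigroup m transition_kernel
  by (rule transition_semigroup[OF sets_m sym])

abbreviation \<gamma> :: real where "\<gamma> \<equiv> bottom_eigenvalue m (semigroup_op X P)"

abbreviation \<mu> :: "'a measure" where "\<mu> \<equiv> density m (\<lambda>x. ennreal ((\<phi> x)\<^sup>2))"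

lemma space_m [simp]: "space m = UNIV"
  using sets_eq_imp_space_eq[OF sets_m] by simp

lemma measurable_m: "f \<in> measurable m N \<longleftrightarrow> f \<in> measurable borel N"
  by (simp add: measurable_cong_sets[OF sets_m refl])

lemma act_eq_semigroup_op:
  "0 \<le> t \<Longrightarrow> f \<in> borel_measurable borel \<Longrightarrow> act t f = semigroup_op X P t f"
  by (auto simp: act_def semigroup_op_eq_integral)

lemma continuous_act:
  "0 < t \<Longrightarrow> f \<in> borel_measurable borel \<Longrightarrow> bounded (range f) \<Longrightarrow> continuous_on UNIV (act t f)"
  using strong_feller act_eq_semigroup_op[of t f]
  unfolding strong_feller_def bounded_borel_def bounded_cont_def by auto

lemma \<phi>_continuous: "continuous_on UNIV \<phi>"
  using \<phi>_cont by (simp add: bounded_cont_def)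

lemma \<phi>_measurable [measurable]: "\<phi> \<in> borel_measurable borel"
  by (rule borel_measurable_continuous_onI[OF \<phi>_continuous])

lemma \<phi>_measurable_m [measurable]: "\<phi> \<in> borel_measurable m"
  by (simp add: measurable_m)

lemma \<phi>_bounded:
  obtains C where "0 < C" "\<And>x. \<phi> x \<le> C"
proof -
  obtain b where "0 < b" "\<And>x. norm (\<phi> x) \<le> b"
    using \<phi>_cont unfolding bounded_cont_def bounded_pos by auto
  then show ?thesis using that[of b] by (metis abs_le_D1 real_norm_def)
qed

lemma \<phi>_L2: "\<phi> \<in> bounded_L2 m" and integral_\<phi>_square: "(\<integral>x. (\<phi> x)\<^sup>2 \<partial>m) = 1"
proof -
  have "\<phi> \<in> L2 m" "L2_norm m \<phi> = 1"
    using ground_state by (auto simp: ground_state_def dirichlet_domain_def)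
  then show "\<phi> \<in> bounded_L2 m" "(\<integral>x. (\<phi> x)\<^sup>2 \<partial>m) = 1"
    using \<phi>_cont by (auto simp: bounded_L2_def bounded_cont_def bounded_iff L2_norm_def)
qed

text \<open>
  The eigenvalue relation holds almost everywhere; both sides are continuous by the strong Feller
  property, so it holds everywhere.
\<close>

lemma act_\<phi>: "0 \<le> t \<Longrightarrow> act t \<phi> x = exp (- \<gamma> * t) * \<phi> x"
proof (cases "t = 0")
  case True
  then show ?thesis by (simp add: act_0)
next
  case False
  assume "0 \<le> t"
  with False have t: "0 < t" by simp
  have eq: "semigroup_op X P s u = act s u" if "0 < s" "u \<in> L2 m" for s u
    using that act_eq_semigroup_op[of s u] by (simp add: L2_def measurable_m)
  have gs: "Defs.ground_state m act \<phi>" and bot: "bottom_eigenvalue m act = \<gamma>"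
    using ground_state ground_state_cong[OF eq] by auto
  have ae: "AE x in m. act t \<phi> x = exp (- \<gamma> * t) * \<phi> x"
    using ground_state_eigenfunction[OF gs \<phi>_L2, of t] t by (simp add: bot)
  have "continuous_on UNIV (act t \<phi>)"
    using \<phi>_cont t by (intro continuous_act) (auto simp: bounded_cont_def)
  moreover have "continuous_on UNIV (\<lambda>x. exp (- \<gamma> * t) * \<phi> x)"
    by (intro continuous_intros \<phi>_continuous)
  moreover have "AE x in m. act t \<phi> x \<le> exp (- \<gamma> * t) * \<phi> x"
    "AE x in m. exp (- \<gamma> * t) * \<phi> x \<le> act t \<phi> x"
    using ae by (eventually_elim, simp)+
  ultimately show ?thesis
    by (intro antisym full_support_AE_le[OF sets_m support])
qed

abbreviation Q :: "real \<Rightarrow> 'a \<Rightarrow> 'a measure" where "Q \<equiv> doob \<gamma> \<phi>"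

lemma sets_\<mu>: "sets \<mu> = sets borel" and space_\<mu>: "space \<mu> = UNIV"
  using sets_m by simp_all

lemma AE_\<mu>_iff: "(AE x in \<mu>. R x) \<longleftrightarrow> (AE x in m. R x)"
  using \<phi>_pos by (subst AE_density) (auto simp: less_le)

lemma null_\<mu>_iff:
  assumes A: "A \<in> sets borel" shows "emeasure \<mu> A = 0 \<longleftrightarrow> emeasure m A = 0"
proof -
  have "A \<in> null_sets \<mu> \<longleftrightarrow> A \<in> null_sets m"
    using A AE_\<mu>_iff[of "\<lambda>x. x \<notin> A"] sets_m
    by (simp add: AE_iff_null_sets)
  then show ?thesis using A sets_m by (simp add: null_sets_def)
qed

lemma prob_space_\<mu>: "prob_space \<mu>"
proof (rule prob_spaceI)
  have "emeasure \<mu> (space \<mu>) = (\<integral>\<^sup>+x. ennreal ((\<phi> x)\<^sup>2) * indicator (space m) x \<partial>m)"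
    by (subst emeasure_density) (auto simp: sets_m)
  also have "\<dots> = (\<integral>\<^sup>+x. ennreal ((\<phi> x)\<^sup>2) \<partial>m)" by (intro nn_integral_cong) simp
  also have "\<dots> = 1"
    using nn_integral_eq_integral[of m "\<lambda>x. (\<phi> x)\<^sup>2"] \<phi>_L2 integral_\<phi>_square
    by (simp add: bounded_L2_def L2_def)
  finally show "emeasure \<mu> (space \<mu>) = 1" .
qed

lemma \<phi>_eigen_nn: "0 \<le> t \<Longrightarrow> (\<integral>\<^sup>+y. ennreal (\<phi> y) \<partial>transition_kernel t x) = ennreal (exp (- \<gamma> * t) * \<phi> x)"
proof -
  assume t: "0 \<le> t"
  obtain C where C: "\<And>x. \<phi> x \<le> C" using \<phi>_bounded by metis
  have "integrable (transition_kernel t x) \<phi>"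
    using C \<phi>_pos by (intro integrable_K[OF t, of _ _ C]) (auto simp: less_imp_le abs_of_pos)
  then show ?thesis
    using \<phi>_pos act_\<phi>[OF t, of x] by (subst nn_integral_eq_integral) (auto simp: act_def less_imp_le)
qed

lemma Q_act:
  assumes "0 \<le> t" "f \<in> borel_measurable borel"
  shows "(\<integral>y. f y \<partial>Q t x) = exp (\<gamma> * t) / \<phi> x * act t (\<lambda>y. \<phi> y * f y) x"
  using assms \<phi>_pos by (intro integral_doob) (auto simp: measurable_m)

text \<open>
  Multiplied by \<open>\<phi>\<close>, both sides of the ultracontractive bound are continuous, so it holds at every
  point. The functions admitted are those with \<open>\<phi> f\<close> bounded, such as \<open>1 / \<phi>\<close>.
\<close>

lemma ultracontractive_pointwise:
  obtains c where "\<And>f x. f \<in> borel_measurable borel \<Longrightarrow> bounded (range (\<lambda>y. \<phi> y * f y)) \<Longrightarrow>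
    integrable \<mu> f \<Longrightarrow> \<bar>\<integral>y. f y \<partial>Q 1 x\<bar> \<le> c * (\<integral>y. \<bar>f y\<bar> \<partial>\<mu>)"
proof -
  obtain c where c: "\<And>f. integrable \<mu> f \<Longrightarrow>
      (AE x in \<mu>. \<bar>ground_state_transform m (semigroup_op X P) \<phi> 1 f x\<bar> \<le> c * (\<integral>y. \<bar>f y\<bar> \<partial>\<mu>))"
    using ultracontractive unfolding intrinsically_ultracontractive_def Let_def
    by (metis zero_less_one)
  show ?thesis
  proof (rule that[of c])
    fix f x assume f [measurable]: "f \<in> borel_measurable borel"
      and b: "bounded (range (\<lambda>y. \<phi> y * f y))" and i: "integrable \<mu> f"
    let ?I = "\<integral>y. \<bar>f y\<bar> \<partial>\<mu>" and ?A = "act 1 (\<lambda>y. \<phi> y * f y)"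
    have gst: "ground_state_transform m (semigroup_op X P) \<phi> 1 f x = exp \<gamma> / \<phi> x * ?A x" for x
      unfolding ground_state_transform_def by (simp add: act_eq_semigroup_op)
    have iff: "\<bar>exp \<gamma> / \<phi> x * ?A x\<bar> \<le> c * ?I \<longleftrightarrow> exp \<gamma> * \<bar>?A x\<bar> \<le> c * ?I * \<phi> x" for x
      using \<phi>_pos[of x] by (simp add: abs_mult pos_divide_le_eq)
    have "AE x in m. exp \<gamma> * \<bar>?A x\<bar> \<le> c * ?I * \<phi> x"
      using c[OF i] unfolding AE_\<mu>_iff gst iff .
    moreover have "continuous_on UNIV (\<lambda>x. exp \<gamma> * \<bar>?A x\<bar>)"
      by (intro continuous_intros continuous_act b) auto
    moreover have "continuous_on UNIV (\<lambda>x. c * ?I * \<phi> x)"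
      by (intro continuous_intros \<phi>_continuous)
    ultimately have "exp \<gamma> * \<bar>?A x\<bar> \<le> c * ?I * \<phi> x"
      by (intro full_support_AE_le[OF sets_m support])
    then show "\<bar>\<integral>y. f y \<partial>Q 1 x\<bar> \<le> c * ?I"
      using iff[of x] by (simp add: Q_act)
  qed
qed

text \<open>
  \<open>Q t x\<close> and the transition kernel have the same null sets, so a set that the transformed process
  neither enters nor leaves can be pulled out of the semigroup of the original process.
\<close>

lemma Q_irreducible:
  assumes A: "A \<in> sets borel"
    and inv: "\<And>t. 0 < t \<Longrightarrow> AE x in \<mu>. AE y in Q t x. y \<in> A \<longleftrightarrow> x \<in> A"
  shows "emeasure \<mu> A = 0 \<or> emeasure \<mu> (UNIV - A) = 0"
proof -
  have "AE x in m. semigroup_op X P t (\<lambda>y. indicator A y * f y) x = indicator A x * semigroup_op X P t f x"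
    if f: "f \<in> L2 m \<inter> bounded_borel" and t: "0 < t" for f t
  proof -
    have fm [measurable]: "f \<in> borel_measurable borel" using f by (simp add: bounded_borel_def)
    have "AE x in m. AE y in Q t x. y \<in> A \<longleftrightarrow> x \<in> A" using inv[OF t] unfolding AE_\<mu>_iff .
    then show ?thesis
    proof eventually_elim
      case (elim x)
      have "AE y in transition_kernel t x. y \<in> A \<longleftrightarrow> x \<in> A"
        using elim \<phi>_pos unfolding doob_def
        by (subst (asm) AE_density) (auto intro!: measurable_K less_imp_le[OF t])
      then have "(\<integral>y. indicator A y * f y \<partial>transition_kernel t x) = (\<integral>y. indicator A x * f y \<partial>transition_kernel t x)"
        using A by (intro integral_cong_AE) (auto simp: indicator_def measurable_cong_sets[OF sets_transition_kernel refl])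
      then show ?case
        using t A by (simp add: semigroup_op_eq_integral)
    qed
  qed
  then have "emeasure m A = 0 \<or> emeasure m (UNIV - A) = 0"
    using irreducible A unfolding irreducible_wrt_def by blast
  then show ?thesis using A by (simp add: null_\<mu>_iff)
qed

lemma ultracontractive_markov_semigroup_Q:
  obtains c where "ultracontractive_markov_semigroup \<mu> Q c"
proof -
  have doob: "symmetric_submarkov_semigroup \<mu> Q"
    and markov: "\<And>t x. 0 \<le> t \<Longrightarrow> emeasure (Q t x) UNIV = 1"
    using doob_semigroup[of \<phi> \<gamma>] doob_markov[of \<phi> \<gamma>] \<phi>_pos \<phi>_eigen_nn by auto
  obtain c where c: "\<And>f x. f \<in> borel_measurable borel \<Longrightarrow> bounded (range (\<lambda>y. \<phi> y * f y)) \<Longrightarrow>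
    integrable \<mu> f \<Longrightarrow> \<bar>\<integral>y. f y \<partial>Q 1 x\<bar> \<le> c * (\<integral>y. \<bar>f y\<bar> \<partial>\<mu>)"
    using ultracontractive_pointwise by blast
  interpret E: symmetric_submarkov_semigroup \<mu> Q by (rule doob)
  interpret prob_space \<mu> by (rule prob_space_\<mu>)
  have "ultracontractive_markov_semigroup \<mu> Q c"
  proof
    show "emeasure (Q t x) (space \<mu>) = 1" if "0 \<le> t" for t x
      using markov[OF that] by (simp add: space_\<mu>)
    show "emeasure \<mu> A = 0 \<or> emeasure \<mu> (space \<mu> - A) = 0"
      if "A \<in> sets \<mu>" "\<And>t. 0 < t \<Longrightarrow> AE x in \<mu>. AE y in Q t x. (y \<in> A) = (x \<in> A)" for A
      using Q_irreducible[of A] that unfolding sets_\<mu> space_\<mu> by blast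
    fix f x assume f: "f \<in> bounded_L2 \<mu>"
    have fm: "f \<in> borel_measurable borel"
      using bounded_L2_measurable[OF f] by (simp add: measurable_m)
    obtain C where C: "\<And>x. \<bar>f x\<bar> \<le> C" using bounded_L2E[OF f] space_\<mu> by (metis UNIV_I)
    obtain D where D: "0 < D" "\<And>x. \<phi> x \<le> D" using \<phi>_bounded by metis
    have "\<bar>\<phi> x * f x\<bar> \<le> D * C" for x
      unfolding abs_mult using C[of x] D \<phi>_pos[of x] by (intro mult_mono) auto
    then have b: "bounded (range (\<lambda>y. \<phi> y * f y))" by (auto intro!: boundedI[of _ "D * C"])
    have "integrable \<mu> f"
      using C bounded_L2_measurable[OF f] by (intro integrable_const_bound[where B=C]) auto
    from c[OF fm b this, of x] show "\<bar>E.act 1 f x\<bar> \<le> c * (\<integral>y. \<bar>f y\<bar> \<partial>\<mu>)"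
      unfolding E.act_def .
  qed
  then show ?thesis using that by blast
qed

text \<open>
  Let \<open>C\<close> be the set where \<open>\<phi>\<close> exceeds a level \<open>\<delta>\<close>, chosen low enough to give \<open>C\<close> positive measure.
  By uniform ergodicity the transformed semigroup brings the indicator of \<open>C\<close> above half its mean
  at some time \<open>t\<close>. Undoing the transform, \<open>k * \<phi> \<le> act t (\<phi> * indicator C)\<close> for a constant
  \<open>k > 0\<close>, and the integral of the right-hand side is at most that of \<open>\<phi> * indicator C \<le> \<phi>^2 / \<delta>\<close>.
\<close>

lemma integrable_\<phi>: "integrable m \<phi>"
proof -
  obtain c where "ultracontractive_markov_semigroup \<mu> Q c"
    using ultracontractive_markov_semigroup_Q by blast
  then interpret E: ultracontractive_markov_semigroup \<mu> Q c .
  fix x\<^sub>0 :: 'a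
  define \<delta> where "\<delta> = \<phi> x\<^sub>0 / 2"
  have \<delta>: "0 < \<delta>" using \<phi>_pos by (simp add: \<delta>_def)
  define C where "C = {x. \<delta> < \<phi> x}"
  have open_C: "open C" unfolding C_def by (rule open_Collect_less[OF _ \<phi>_continuous]) simp
  then have C [measurable]: "C \<in> sets borel" by simp
  have "x\<^sub>0 \<in> C" using \<phi>_pos[of x\<^sub>0] by (simp add: C_def \<delta>_def)
  then have "emeasure m C > 0" using support open_C unfolding full_support_def by blast
  then have "emeasure \<mu> C \<noteq> 0" using null_\<mu>_iff[OF C] by simp
  then have b: "0 < measure \<mu> C" by (simp add: E.emeasure_eq_measure zero_less_measure_iff)
  define f :: "'a \<Rightarrow> real" where "f = indicator C"
  have f: "f \<in> bounded_L2 \<mu>"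
    using C by (intro E.bounded_L2I[of _ 1]) (auto simp: f_def measurable_m indicator_def)
  have "(\<integral>y. f y \<partial>\<mu>) = measure \<mu> C" by (simp add: f_def space_\<mu>)
  then have "\<forall>\<^sub>F t in at_top. \<forall>x\<in>space \<mu>. dist (E.act t f x) (measure \<mu> C) < measure \<mu> C / 2"
    using E.uniform_ergodicity[OF f] half_gt_zero[OF b] unfolding uniform_limit_iff by (simp only:)
  then obtain T where T: "\<And>t x. T \<le> t \<Longrightarrow> dist (E.act t f x) (measure \<mu> C) < measure \<mu> C / 2"
    unfolding eventually_at_top_linorder space_\<mu> by auto
  define t where "t = max T 0"
  have t: "0 \<le> t" "T \<le> t" by (auto simp: t_def)
  define k where "k = exp (- \<gamma> * t) * (measure \<mu> C / 2)"
  have k: "0 < k" using b by (simp add: k_def)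
  have fm [measurable]: "f \<in> borel_measurable borel" by (simp add: f_def)
  let ?g = "\<lambda>y. \<phi> y * f y"
  have low: "k * \<phi> x \<le> act t ?g x" for x
  proof -
    have "measure \<mu> C / 2 \<le> E.act t f x" using T[OF t(2), of x] unfolding dist_real_def by linarith
    also have "E.act t f x = exp (\<gamma> * t) / \<phi> x * act t ?g x"
      unfolding E.act_def by (rule Q_act[OF t(1) fm])
    finally have "exp (- \<gamma> * t) * \<phi> x * (measure \<mu> C / 2)
        \<le> exp (- \<gamma> * t) * \<phi> x * (exp (\<gamma> * t) / \<phi> x * act t ?g x)"
      using \<phi>_pos[of x] by (intro mult_left_mono) auto
    also have "\<dots> = act t ?g x"
      using \<phi>_pos[of x] by (simp add: exp_minus field_simps)
    finally show ?thesis by (simp add: k_def mult_ac)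
  qed
  obtain D where D: "0 < D" "\<And>x. \<phi> x \<le> D" using \<phi>_bounded by metis
  have act_nn: "ennreal (act t ?g x) = (\<integral>\<^sup>+y. ennreal (?g y) \<partial>transition_kernel t x)" for x
  proof -
    have "integrable (transition_kernel t x) ?g"
      using D \<phi>_pos
      by (intro integrable_K[OF t(1), of _ _ D])
         (auto simp: f_def indicator_def measurable_m less_imp_le abs_of_pos)
    then show ?thesis
      using \<phi>_pos unfolding act_def
      by (intro nn_integral_eq_integral[symmetric]) (auto simp: f_def indicator_def less_imp_le)
  qed
  have "ennreal k * (\<integral>\<^sup>+x. ennreal (\<phi> x) \<partial>m) = (\<integral>\<^sup>+x. ennreal (k * \<phi> x) \<partial>m)"
    using k \<phi>_pos by (subst nn_integral_cmult[symmetric]) (auto simp: ennreal_mult less_imp_le)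
  also have "\<dots> \<le> (\<integral>\<^sup>+x. ennreal (act t ?g x) \<partial>m)"
    using low by (intro nn_integral_mono ennreal_leI)
  also have "\<dots> \<le> (\<integral>\<^sup>+x. ennreal (?g x) \<partial>m)"
    unfolding act_nn by (rule nn_integral_K_le[OF t(1)]) (simp add: measurable_m)
  also have "\<dots> \<le> (\<integral>\<^sup>+x. ennreal ((\<phi> x)\<^sup>2 / \<delta>) \<partial>m)"
  proof (intro nn_integral_mono ennreal_leI)
    fix x
    have "\<phi> x * \<delta> \<le> \<phi> x * \<phi> x" if "x \<in> C"
      using that \<phi>_pos[of x] by (intro mult_left_mono) (auto simp: C_def)
    then show "?g x \<le> (\<phi> x)\<^sup>2 / \<delta>"
      using \<delta> by (auto simp: f_def indicator_def power2_eq_square field_simps)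
  qed
  also have "\<dots> < \<infinity>"
    using \<phi>_L2 \<delta> by (subst nn_integral_eq_integral) (auto simp: bounded_L2_def L2_def)
  finally have "(\<integral>\<^sup>+x. ennreal (\<phi> x) \<partial>m) < \<infinity>"
    using k by (auto simp: ennreal_mult_less_top)
  then show ?thesis
    using \<phi>_pos by (intro integrableI_nonneg) (auto simp: less_imp_le)
qed

text \<open>
  The function \<open>f = indicator B / \<phi>\<close> is integrable with respect to \<open>\<mu>\<close> because \<open>\<phi>\<close> is integrable
  with respect to \<open>m\<close>. It may be unbounded, but after one unit of time the transformed semigroup has
  made it bounded without changing its mean, so uniform ergodicity applies to the result.
\<close>

theorem act_indicator_asymptotics:
  assumes B: "B \<in> sets borel"
  shows "uniform_limit UNIV (\<lambda>t x. exp (\<gamma> * t) / \<phi> x * act t (indicator B) x) (\<lambda>_. \<integral>y. indicator B y * \<phi> y \<partial>m) at_top"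
proof -
  obtain c where "ultracontractive_markov_semigroup \<mu> Q c"
    using ultracontractive_markov_semigroup_Q by blast
  then interpret E: ultracontractive_markov_semigroup \<mu> Q c .
  obtain c' where c': "\<And>f x. f \<in> borel_measurable borel \<Longrightarrow> bounded (range (\<lambda>y. \<phi> y * f y)) \<Longrightarrow>
    integrable \<mu> f \<Longrightarrow> \<bar>\<integral>y. f y \<partial>Q 1 x\<bar> \<le> c' * (\<integral>y. \<bar>f y\<bar> \<partial>\<mu>)"
    using ultracontractive_pointwise by blast
  have B' [measurable]: "B \<in> sets m" using B sets_m by simp
  note B [measurable]
  define f where "f x = indicator B x / \<phi> x" for x
  define g where "g = E.act 1 f"
  have \<phi>f: "\<phi> x * f x = indicator B x" for x using \<phi>_pos[of x] by (simp add: f_def)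
  have fm [measurable]: "f \<in> borel_measurable borel" unfolding f_def by measurable
  have f0: "0 \<le> f x" for x using \<phi>_pos[of x] by (simp add: f_def)
  have sq: "(\<phi> x)\<^sup>2 * f x = indicator B x * \<phi> x" for x
    using \<phi>f[of x] by (simp add: power2_eq_square mult.assoc mult.commute)
  have int_B: "integrable m (\<lambda>x. indicator B x * \<phi> x)"
    using integrable_mult_indicator[OF B' integrable_\<phi>] by simp
  have fi: "integrable \<mu> f"
    using int_B by (subst integrable_density) (auto simp: measurable_m sq)
  have f_mean: "(\<integral>y. f y \<partial>\<mu>) = (\<integral>y. indicator B y * \<phi> y \<partial>m)"
    by (subst integral_density) (auto simp: measurable_m sq)
  have g_eq: "g x = exp \<gamma> / \<phi> x * act 1 (indicator B) x" for x
    unfolding g_def E.act_def using Q_act[of 1 f x] by (simp add: \<phi>f)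
  have g_bound: "\<bar>g x\<bar> \<le> c' * (\<integral>y. \<bar>f y\<bar> \<partial>\<mu>)" for x
    unfolding g_def E.act_def
    by (rule c'[OF fm _ fi]) (auto simp: \<phi>f indicator_def intro!: boundedI[of _ 1])
  have gm: "g \<in> borel_measurable borel"
    using E.act_measurable[of 1 f] fm by (simp add: g_def measurable_m)
  have g: "g \<in> bounded_L2 \<mu>"
    using gm g_bound by (intro E.bounded_L2I) (auto simp: measurable_m)
  have g_mean: "(\<integral>y. g y \<partial>\<mu>) = (\<integral>y. f y \<partial>\<mu>)"
  proof -
    have g0: "0 \<le> g x" for x unfolding g_def E.act_def using f0 by simp
    have nn: "ennreal (g x) = (\<integral>\<^sup>+y. ennreal (f y) \<partial>Q 1 x)" for x
    proof -
      interpret K: subprob_space "transition_kernel 1 x" by (rule subprob_transition_kernel) simp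
      have "(\<integral>\<^sup>+y. ennreal (f y) \<partial>Q 1 x)
          = ennreal (exp (\<gamma> * 1) / \<phi> x) * (\<integral>\<^sup>+y. ennreal (\<phi> y) * ennreal (f y) \<partial>transition_kernel 1 x)"
        using \<phi>_pos by (intro nn_integral_doob) (auto simp: measurable_m)
      also have "(\<lambda>y. ennreal (\<phi> y) * ennreal (f y)) = indicator B"
        using \<phi>_pos by (auto simp: \<phi>f less_imp_le f0 indicator_def fun_eq_iff simp flip: ennreal_mult)
      also have "(\<integral>\<^sup>+y. indicator B y \<partial>transition_kernel 1 x) = ennreal (act 1 (indicator B) x)"
        by (simp add: act_def K.emeasure_eq_measure)
      also have "ennreal (exp (\<gamma> * 1) / \<phi> x) * ennreal (act 1 (indicator B) x) = ennreal (g x)"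
        using \<phi>_pos[of x] by (simp add: g_eq act_def flip: ennreal_mult)
      finally show ?thesis ..
    qed
    have "(\<integral>y. g y \<partial>\<mu>) = enn2real (\<integral>\<^sup>+x. ennreal (g x) \<partial>\<mu>)"
      using g0 gm by (intro integral_eq_nn_integral) (auto simp: measurable_m)
    also have "(\<integral>\<^sup>+x. ennreal (g x) \<partial>\<mu>) = (\<integral>\<^sup>+x. ennreal (f x) * (\<integral>\<^sup>+y. 1 \<partial>Q 1 x) \<partial>\<mu>)"
      using E.nn_symmetric[of 1 "\<lambda>x. ennreal (f x)" "\<lambda>_. 1"] fm unfolding nn by (simp add: measurable_m)
    also have "\<dots> = (\<integral>\<^sup>+x. ennreal (f x) \<partial>\<mu>)"
      using E.markov[of 1] E.space_K[of 1] by (intro nn_integral_cong) (simp add: space_\<mu>)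
    also have "enn2real \<dots> = (\<integral>y. f y \<partial>\<mu>)"
      using f0 fm by (intro integral_eq_nn_integral[symmetric]) (auto simp: measurable_m)
    finally show ?thesis .
  qed
  have Q_g: "E.act t g x = exp (\<gamma> * (t + 1)) / \<phi> x * act (t + 1) (indicator B) x" if t: "0 \<le> t" for t x
  proof -
    have "(\<lambda>y. \<phi> y * g y) = (\<lambda>y. exp \<gamma> * act 1 (indicator B) y)"
      using \<phi>_pos by (auto simp: g_eq fun_eq_iff field_simps less_imp_neq[symmetric])
    then have "E.act t g x = exp (\<gamma> * t) / \<phi> x * act t (\<lambda>y. exp \<gamma> * act 1 (indicator B) y) x"
      unfolding E.act_def using Q_act[OF t gm, of x] by simp
    also have "act t (\<lambda>y. exp \<gamma> * act 1 (indicator B) y) x = exp \<gamma> * act t (act 1 (indicator B)) x"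
      by (simp add: act_def)
    also have "act t (act 1 (indicator B)) x = act (t + 1) (indicator B) x"
      using act_act[of 1 t x "indicator B" 1] t by (auto simp: add.commute indicator_def)
    finally show ?thesis by (simp add: distrib_left exp_add)
  qed
  show ?thesis
    unfolding uniform_limit_iff
  proof (intro allI impI)
    fix e :: real assume "0 < e"
    let ?L = "\<integral>y. indicator B y * \<phi> y \<partial>m"
    have "\<forall>\<^sub>F t in at_top. \<forall>x\<in>space \<mu>. dist (E.act t g x) ?L < e"
      using E.uniform_ergodicity[OF g] \<open>0 < e\<close> unfolding g_mean f_mean uniform_limit_iff by blast
    then obtain T where T: "\<And>t x. T \<le> t \<Longrightarrow> dist (E.act t g x) ?L < e"
      unfolding eventually_at_top_linorder space_\<mu> by auto
    show "\<forall>\<^sub>F t in at_top. \<forall>x\<in>UNIV. dist (exp (\<gamma> * t) / \<phi> x * act t (indicator B) x) ?L < e"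
      unfolding eventually_at_top_linorder
    proof (intro exI[of _ "max T 0 + 1"] allI impI ballI)
      fix t x assume "max T 0 + 1 \<le> t"
      then show "dist (exp (\<gamma> * t) / \<phi> x * act t (indicator B) x) ?L < e"
        using T[of "t - 1" x] Q_g[of "t - 1" x] by simp
    qed
  qed
qed


text \<open>
  The convergence in \<open>act_indicator_asymptotics\<close> is uniform and \<open>\<phi>\<close> is bounded, so the limit passes
  through the integral over any initial law.
\<close>

theorem survival_asymptotics:
  assumes \<nu>: "prob_space \<nu>" "sets \<nu> = sets borel" and B: "B \<in> sets borel"
  shows "((\<lambda>t. exp (\<gamma> * t) * prob_init P \<nu> {\<omega> \<in> space M. X t \<omega> \<in> Some ` B})
    \<longlongrightarrow> (\<integral>x. \<phi> x \<partial>\<nu>) * (\<integral>y. indicator B y * \<phi> y \<partial>m)) at_top"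
proof -
  interpret \<nu>: prob_space \<nu> by (rule \<nu>(1))
  note B [measurable]
  let ?L = "\<integral>y. indicator B y * \<phi> y \<partial>m"
  let ?u = "\<lambda>t x. exp (\<gamma> * t) * act t (indicator B) x"
  have m\<nu>: "h \<in> borel_measurable \<nu> \<longleftrightarrow> h \<in> borel_measurable borel" for h :: "'a \<Rightarrow> real"
    by (simp add: measurable_cong_sets[OF \<nu>(2) refl])
  obtain D where D: "0 < D" "\<And>x. \<phi> x \<le> D" using \<phi>_bounded by metis
  have i\<phi>: "integrable \<nu> (\<lambda>x. \<phi> x * ?L)"
    using D \<phi>_pos by (intro integrable_mult_left \<nu>.integrable_const_bound[where B=D])
      (auto simp: m\<nu> less_imp_le abs_of_pos)
  have prob: "prob_init P \<nu> {\<omega> \<in> space M. X t \<omega> \<in> Some ` B} = (\<integral>x. act t (indicator B) x \<partial>\<nu>)"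
    and iu: "integrable \<nu> (?u t)" if t: "0 \<le> t" for t
  proof -
    have "measure (P (Some x)) {\<omega> \<in> space M. X t \<omega> \<in> Some ` B} = act t (indicator B) x" for x
    proof -
      have "act t (indicator B) x = measure (transition_kernel t x) B" by (simp add: act_def)
      also have "\<dots> = measure (P (Some x)) (X t -` Some ` B \<inter> space M)"
        using emeasure_transition_kernel[OF t B, of x] by (simp add: measure_def)
      also have "X t -` Some ` B \<inter> space M = {\<omega> \<in> space M. X t \<omega> \<in> Some ` B}" by auto
      finally show ?thesis ..
    qed
    then show "prob_init P \<nu> {\<omega> \<in> space M. X t \<omega> \<in> Some ` B} = (\<integral>x. act t (indicator B) x \<partial>\<nu>)"
      by (simp add: prob_init_def)
    have "act t (indicator B) \<in> borel_measurable borel"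
      using act_measurable[OF t, of "indicator B"] by (simp add: measurable_m)
    moreover have "\<bar>act t (indicator B) x\<bar> \<le> 1" for x
      by (rule act_abs_le[OF t]) (auto simp: measurable_m indicator_def)
    ultimately show "integrable \<nu> (?u t)"
      by (intro integrable_mult_right \<nu>.integrable_const_bound[where B=1]) (auto simp: m\<nu>)
  qed
  show ?thesis
    unfolding tendsto_iff
  proof (intro allI impI)
    fix e :: real assume e: "0 < e"
    define \<delta> where "\<delta> = e / (2 * D)"
    have \<delta>: "0 < \<delta>" using e D by (simp add: \<delta>_def)
    have "\<forall>\<^sub>F t in at_top. \<forall>x\<in>UNIV. dist (exp (\<gamma> * t) / \<phi> x * act t (indicator B) x) ?L < \<delta>"
      using act_indicator_asymptotics[OF B] \<delta> unfolding uniform_limit_iff by blast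
    then show "\<forall>\<^sub>F t in at_top. dist (exp (\<gamma> * t) * prob_init P \<nu> {\<omega> \<in> space M. X t \<omega> \<in> Some ` B})
        ((\<integral>x. \<phi> x \<partial>\<nu>) * ?L) < e"
      using eventually_ge_at_top[of 0]
    proof eventually_elim
      case (elim t)
      have close: "\<bar>?u t x - \<phi> x * ?L\<bar> \<le> e / 2" for x
      proof -
        have "\<bar>?u t x - \<phi> x * ?L\<bar> = \<phi> x * \<bar>exp (\<gamma> * t) / \<phi> x * act t (indicator B) x - ?L\<bar>"
        proof -
          have "?u t x - \<phi> x * ?L = \<phi> x * (exp (\<gamma> * t) / \<phi> x * act t (indicator B) x - ?L)"
            using \<phi>_pos[of x] by (simp add: right_diff_distrib)
          then show ?thesis using \<phi>_pos[of x] by (simp add: abs_mult)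
        qed
        also have "\<dots> \<le> D * \<delta>"
          using elim(1) D \<phi>_pos[of x] by (intro mult_mono) (auto simp: dist_real_def less_imp_le)
        finally show ?thesis using D by (simp add: \<delta>_def)
      qed
      have "\<bar>(\<integral>x. ?u t x - \<phi> x * ?L \<partial>\<nu>)\<bar> \<le> (\<integral>x. \<bar>?u t x - \<phi> x * ?L\<bar> \<partial>\<nu>)"
        by (rule integral_abs_bound)
      also have "\<dots> \<le> (\<integral>x. e / 2 \<partial>\<nu>)"
        using close iu[OF elim(2)] i\<phi> by (intro integral_mono) auto
      also have "\<dots> < e" using e by (simp add: \<nu>.prob_space)
      finally have "\<bar>(\<integral>x. ?u t x \<partial>\<nu>) - (\<integral>x. \<phi> x * ?L \<partial>\<nu>)\<bar> < e"
        using iu[OF elim(2)] i\<phi> by (simp add: Bochner_Integration.integral_diff)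
      then show ?case
        unfolding prob[OF elim(2)] by (simp add: dist_real_def)
    qed
  qed
qed

lemma alive_iff_before_lifetime:
  assumes "0 < t"
  shows "{\<omega> \<in> space M. ereal t < lifetime X \<omega>} = {\<omega> \<in> space M. X t \<omega> \<in> Some ` UNIV}"
proof (intro Collect_cong conj_cong refl)
  fix \<omega> assume \<omega>: "\<omega> \<in> space M"
  have "lifetime X \<omega> \<le> ereal t" if "X t \<omega> = None"
    unfolding lifetime_def using that assms by (intro Inf_lower) auto
  moreover have "X t \<omega> = None" if "lifetime X \<omega> \<le> ereal t"
    using dead_after_lifetime[OF \<omega> _ that] assms by simp
  moreover have "X t \<omega> \<in> Some ` UNIV \<longleftrightarrow> X t \<omega> \<noteq> None" by (auto simp: image_iff)
  ultimately show "ereal t < lifetime X \<omega> \<longleftrightarrow> X t \<omega> \<in> Some ` UNIV" by (auto simp: not_le[symmetric])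
qed

text \<open>
  Numerator and denominator of the conditional probability decay at the same exponential rate and
  carry the same factor \<open>\<integral> \<phi> d\<nu>\<close> from the initial law; both cancel in the quotient.
\<close>

theorem quasi_stationary_limit:
  assumes \<nu>: "prob_space \<nu>" "sets \<nu> = sets borel" and B: "B \<in> sets borel"
  shows "((\<lambda>t. cond_prob_init P \<nu>
             {\<omega> \<in> space M. X t \<omega> \<in> Some ` B} {\<omega> \<in> space M. ereal t < lifetime X \<omega>})
          \<longlongrightarrow> ground_state_law m \<phi> B) at_top"
proof -
  interpret \<nu>: prob_space \<nu> by (rule \<nu>(1))
  let ?p = "\<lambda>B t. prob_init P \<nu> {\<omega> \<in> space M. X t \<omega> \<in> Some ` B}"
  have pos: "0 < (\<integral>x. \<phi> x \<partial>N)" if "integrable N \<phi>" "emeasure N (space N) \<noteq> 0" for N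
  proof -
    have "(\<integral>x. \<phi> x \<partial>N) \<noteq> 0"
    proof
      assume "(\<integral>x. \<phi> x \<partial>N) = 0"
      then have "AE x in N. \<phi> x = 0"
        using integral_nonneg_eq_0_iff_AE[OF that(1)] \<phi>_pos by (simp add: less_imp_le)
      then have "AE x in N. False" using \<phi>_pos by (simp add: less_imp_neq[symmetric])
      then show False using that(2) by (simp add: eventually_False ae_filter_eq_bot_iff)
    qed
    moreover have "0 \<le> (\<integral>x. \<phi> x \<partial>N)" using \<phi>_pos by (simp add: less_imp_le)
    ultimately show ?thesis by linarith
  qed
  obtain D where D: "0 < D" "\<And>x. \<phi> x \<le> D" using \<phi>_bounded by metis
  have "integrable \<nu> \<phi>"
    using D \<phi>_pos by (intro \<nu>.integrable_const_bound[where B=D])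
      (auto simp: measurable_cong_sets[OF \<nu>(2) refl] less_imp_le abs_of_pos)
  then have \<nu>_pos: "0 < (\<integral>x. \<phi> x \<partial>\<nu>)" by (rule pos) (simp add: \<nu>.emeasure_space_1)
  have m_pos: "0 < (\<integral>x. \<phi> x \<partial>m)"
    using support by (intro pos integrable_\<phi>) (auto simp: full_support_def)
  have "((\<lambda>t. (exp (\<gamma> * t) * ?p B t) / (exp (\<gamma> * t) * ?p UNIV t))
      \<longlongrightarrow> ((\<integral>x. \<phi> x \<partial>\<nu>) * (\<integral>y. indicator B y * \<phi> y \<partial>m)) /
         ((\<integral>x. \<phi> x \<partial>\<nu>) * (\<integral>y. indicator UNIV y * \<phi> y \<partial>m))) at_top"
    using \<nu>_pos m_pos by (intro tendsto_divide survival_asymptotics \<nu> B) auto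
  moreover have "((\<integral>x. \<phi> x \<partial>\<nu>) * (\<integral>y. indicator B y * \<phi> y \<partial>m)) /
         ((\<integral>x. \<phi> x \<partial>\<nu>) * (\<integral>y. indicator UNIV y * \<phi> y \<partial>m)) = ground_state_law m \<phi> B"
    using \<nu>_pos by (simp add: ground_state_law_def set_lebesgue_integral_def)
  moreover have "\<forall>\<^sub>F t in at_top. (exp (\<gamma> * t) * ?p B t) / (exp (\<gamma> * t) * ?p UNIV t)
      = cond_prob_init P \<nu> {\<omega> \<in> space M. X t \<omega> \<in> Some ` B} {\<omega> \<in> space M. ereal t < lifetime X \<omega>}"
    using eventually_gt_at_top[of 0]
  proof eventually_elim
    case (elim t)
    have "{\<omega> \<in> space M. X t \<omega> \<in> Some ` B} \<inter> {\<omega> \<in> space M. X t \<omega> \<in> Some ` UNIV}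
        = {\<omega> \<in> space M. X t \<omega> \<in> Some ` B}" by auto
    then show ?case
      unfolding cond_prob_init_def alive_iff_before_lifetime[OF elim] by simp
  qed
  ultimately show ?thesis using Lim_transform_eventually by fastforce
qed

end

theorem lemma3p7:
  fixes m :: "'a::{metric_space, second_countable_topology} measure"
    and M :: "'w measure"
    and X :: "real \<Rightarrow> 'w \<Rightarrow> 'a option"
    and P :: "'a option \<Rightarrow> 'w measure"
    and \<phi>\<^sub>0 :: "'a \<Rightarrow> real"
    and \<nu> :: "'a measure"
    and B :: "'a set"
  assumes "locally_compact_space (euclidean :: 'a topology)"
    and "radon_measure m" and "full_support m"
    and "markov_process M X P"
    and "symmetric_wrt m (semigroup_op X P)"
    and "explosive M X P"
    and "class_T m X P"
    and "ground_state m (semigroup_op X P) \<phi>\<^sub>0"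
    and "\<phi>\<^sub>0 \<in> bounded_cont" and "\<And>x. \<phi>\<^sub>0 x > 0"
    and "intrinsically_ultracontractive m (semigroup_op X P) \<phi>\<^sub>0"
    and "prob_space \<nu>" and "sets \<nu> = sets borel"
    and "B \<in> sets borel"
  shows "((\<lambda>t. cond_prob_init P \<nu>
             {\<omega> \<in> space M. X t \<omega> \<in> Some ` B} {\<omega> \<in> space M. ereal t < lifetime X \<omega>})
          \<longlongrightarrow> ground_state_law m \<phi>\<^sub>0 B) at_top"
proof -
  interpret markov_process M X P by fact
  interpret ultracontractive_process M X P m \<phi>\<^sub>0
    using assms unfolding radon_measure_def class_T_def by unfold_locales auto
  show ?thesis by (rule quasi_stationary_limit) fact+
qed

end
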